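(* For every $\delta_0\in(0,H/2)$ there exists $T_0>0$, depending (besides $\delta_0$) only on the bounds of the energy inequality and on $H$ (in particular not on $\tau$), such that every solution of the semi-discrete scheme (S1)--(S2) described in the context satisfies $$\inf_{[0,T_0]\times\Sigma}\eta_\tau(t,r)\ge\delta_0-H .$$
   Context: Geometry and time grid. $d\in\{2,3\}$, $H>0$, $\Sigma=[0,L_1]\times\cdots\times[0,L_{d-1}]$, $\widehat\Omega=\Sigma\times[0,H]$, points $x=(r,x_d)$ with $r\in\Sigma$. $T>0$, $N_T\in\mathbb N$, $\tau=T/N_T$, $t^k=k\tau$, $I^k=[t^k,t^{k+1})$. For displacements $\eta^k:\Sigma\to(-H,\infty)$ put $\mathcal A^k(\hat r,\hat x_d)=\big(\hat r,\hat x_d\frac{H+\eta^k(\hat r)}{H}\big)$, $\Omega^k=\mathcal A^k(\widehat\Omega)$, $X_k^{k-1}=\mathcal A^{k-1}\circ(\mathcal A^k)^{-1}$, $\mathcal F_k^{k-1}(x)=\frac{H+\eta^{k-1}(r)}{H+\eta^k(r)}$. $\Gamma_S=\{x_d=H+\eta^k(r)\}$ is the top boundary of $\Omega^k$, $\Gamma_D$ the rest. $\delta_tr^k=(r^k-r^{k-1})/\tau$; $D_tr^k=\frac{r^k-(r^{k-1}\circ X_k^{k-1})\mathcal F_k^{k-1}}{\tau}$; $z^k=\delta_t\eta^k$, $\mathbf w^k=\big(\mathbf0_{d-1},z^k(r)\frac{x_d}{H+\eta^k(r)}\big)^T$, $\mathbf v^k=\mathbf u^k-\mathbf w^k$. $a>0,\gamma>1,\mu>0,\mu+\lambda\ge0,\alpha>0,\beta\ge0$;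 $p(\varrho)=a\varrho^\gamma$, $\mathbf S(\nabla\mathbf u)=2\mu\mathbf D(\mathbf u)+\lambda\,\mathrm{div}\,\mathbf u\,\mathbf I$, $\mathbf D(\mathbf u)$ the symmetric gradient; $\mathbf f^k=\frac1\tau\int_{I^k}\mathbf f\,dt$, $g^k=\frac1\tau\int_{I^k}g\,dt$. Semi-discrete scheme. Spaces $W(\Sigma)\subset W^{2,2}_0(\Sigma)$, $Q(\Omega^k)\subset L^\gamma(\Omega^k)$, $V(\Omega^k)\subset W^{1,s}(\Omega^k)$ for all $s<2$. For $k=1,\dots,N_T$, $(\eta^k,\varrho^k,\mathbf u^k)\in W(\Sigma)\times Q(\Omega^k)\times V(\Omega^k)$ satisfies, for all admissible $(\psi,\varphi,\boldsymbol\Psi)$ in these spaces with $\boldsymbol\Psi|_{\Gamma_S}\circ\mathcal A^k=\psi\mathbf e_d$, $\boldsymbol\Psi=0$ on $\Gamma_D$: (S1) $\int_{\Omega^k}D_t\varrho^k\varphi\,dx+\int_{\Omega^k}\mathrm{div}(\varrho^k\mathbf v^k)\varphi\,dx=0$; (S2) $\int_{\Omega^k}\big(D_t(\varrho^k\mathbf u^k)+\mathrm{div}(\varrho^k\mathbf u^k\otimes\mathbf v^k)\big)\cdot\boldsymbol\Psi\,dx+\int_{\Omega^k}\mathbf S(\nabla\mathbf u^k):\nabla\boldsymbol\Psi\,dx-\int_{\Omega^k}p(\varrho^k)\mathrm{div}\boldsymbol\Psi\,dx+\int_\Sigma\delta_tz^k\psi\,dr+\alpha\int_\Sigma\Delta\eta^k\Delta\psi\,dr+\beta\int_\Sigma\nabla\eta^k\cdot\nabla\psi\,dr=\int_{\Omega^k}\varrho^k\mathbf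 f^k\cdot\boldsymbol\Psi\,dx+\int_\Sigma g^k\psi\,dr$, with $\varrho^0=\varrho_0\ge0$, $\mathbf u^0=\mathbf u_0$, $\eta^0=0$, $z^0=0$, $\mathbf u^k=\mathbf w^k$ on $\partial\Omega^k$. Solutions are assumed to exist with enough regularity. $\eta_\tau(t,\cdot)=\eta^k$ for $t\in I^k$. "Bounds of the energy inequality": a constant $c$ independent of $\tau$ (depending on the initial data and on $\mathbf f,g$) which bounds $\max_k\|\varrho^k\|_{L^\gamma(\Omega^k)}$, $\max_k\|\varrho^k|\mathbf u^k|^2\|_{L^1(\Omega^k)}$, $\sum_k\tau\|\mathbf u^k\|^2_{L^6(\Omega^k)}$, $\sum_k\tau\|\nabla\mathbf u^k\|_{L^2(\Omega^k)}^2$, $\max_k\|z^k\|_{L^2(\Sigma)}$, $\alpha\max_k\|\Delta\eta^k\|_{L^2(\Sigma)}$ and $\beta\max_k\|\nabla\eta^k\|_{L^2(\Sigma)}$. Times are restricted to $[0,T]$, i.e. $T_0\le T$. *)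

theory Defs
  imports "HOL-Analysis.Analysis"
begin

section \<open>Smooth functions, weak derivatives, Lebesgue and Sobolev spaces\<close>

definition partial :: "'a \<Rightarrow> ('a::euclidean_space \<Rightarrow> 'b::real_normed_vector) \<Rightarrow> 'a \<Rightarrow> 'b" where
  "partial i f x = frechet_derivative f (at x) i"

fun Ck :: "nat \<Rightarrow> ('a::euclidean_space \<Rightarrow> 'b::real_normed_vector) \<Rightarrow> bool" where
  "Ck 0 f \<longleftrightarrow> continuous_on UNIV f"
| "Ck (Suc k) f \<longleftrightarrow> (\<forall>x. f differentiable (at x)) \<and> (\<forall>i\<in>Basis. Ck k (partial i f))"

definition smooth :: "('a::euclidean_space \<Rightarrow> 'b::real_normed_vector) \<Rightarrow> bool" where
  "smooth f \<longleftrightarrow> (\<forall>k. Ck k f)"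

definition test_fun :: "'a set \<Rightarrow> ('a::euclidean_space \<Rightarrow> 'b::real_normed_vector) \<Rightarrow> bool" where
  "test_fun U \<phi> \<longleftrightarrow> smooth \<phi> \<and> compact (closure {x. \<phi> x \<noteq> 0}) \<and> closure {x. \<phi> x \<noteq> 0} \<subseteq> U"

definition loc_integrable :: "'a set \<Rightarrow> ('a::euclidean_space \<Rightarrow> 'b::euclidean_space) \<Rightarrow> bool" where
  "loc_integrable U f \<longleftrightarrow> (\<forall>K. compact K \<and> K \<subseteq> U \<longrightarrow> set_integrable lebesgue K f)"

definition has_weak_partial ::
  "'a set \<Rightarrow> 'a \<Rightarrow> ('a::euclidean_space \<Rightarrow> 'b::euclidean_space) \<Rightarrow> ('a \<Rightarrow> 'b) \<Rightarrow> bool" where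
  "has_weak_partial U i f g \<longleftrightarrow> loc_integrable U f \<and> loc_integrable U g \<and>
     (\<forall>\<phi>::'a \<Rightarrow> real. test_fun U \<phi> \<longrightarrow>
        (LINT x:U|lebesgue. partial i \<phi> x *\<^sub>R f x) = - (LINT x:U|lebesgue. \<phi> x *\<^sub>R g x))"

text \<open>Weak derivatives and weak divergences are determined only up to null sets; the operators
  below pick a representative. They are meaningful only where a weak derivative exists.\<close>

definition weak_partial ::
  "'a set \<Rightarrow> 'a \<Rightarrow> ('a::euclidean_space \<Rightarrow> 'b::euclidean_space) \<Rightarrow> 'a \<Rightarrow> 'b" where
  "weak_partial U i f = (SOME g. has_weak_partial U i f g)"

definition has_weak_div ::
  "'a set \<Rightarrow> ('a::euclidean_space \<Rightarrow> 'a) \<Rightarrow> ('a \<Rightarrow> real) \<Rightarrow> bool" where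
  "has_weak_div U F g \<longleftrightarrow> loc_integrable U F \<and> loc_integrable U g \<and>
     (\<forall>\<phi>::'a \<Rightarrow> real. test_fun U \<phi> \<longrightarrow>
        (LINT x:U|lebesgue. (\<Sum>i\<in>Basis. (F x \<bullet> i) * partial i \<phi> x))
        = - (LINT x:U|lebesgue. g x * \<phi> x))"

definition weak_div :: "'a set \<Rightarrow> ('a::euclidean_space \<Rightarrow> 'a) \<Rightarrow> 'a \<Rightarrow> real" where
  "weak_div U F = (SOME g. has_weak_div U F g)"

definition weak_grad :: "'a set \<Rightarrow> ('a::euclidean_space \<Rightarrow> real) \<Rightarrow> 'a \<Rightarrow> 'a" where
  "weak_grad U f x = (\<Sum>i\<in>Basis. weak_partial U i f x *\<^sub>R i)"

definition weak_laplacian :: "'a set \<Rightarrow> ('a::euclidean_space \<Rightarrow> real) \<Rightarrow> 'a \<Rightarrow> real" where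
  "weak_laplacian U f x = (\<Sum>i\<in>Basis. weak_partial U i (weak_partial U i f) x)"

definition Lp :: "real \<Rightarrow> 'a set \<Rightarrow> ('a::euclidean_space \<Rightarrow> 'b::euclidean_space) set" where
  "Lp p S = {f. set_borel_measurable lebesgue S f \<and>
                set_integrable lebesgue S (\<lambda>x. norm (f x) powr p)}"

definition Lp_norm :: "real \<Rightarrow> 'a set \<Rightarrow> ('a::euclidean_space \<Rightarrow> 'b::euclidean_space) \<Rightarrow> real" where
  "Lp_norm p S f = (LINT x:S|lebesgue. norm (f x) powr p) powr (1 / p)"

text \<open>\<open>Wkp k p U\<close> is $W^{k,p}(U)$ for open \<open>U\<close>. The norm sums over all iterated
  derivatives, hence is equivalent to the usual one.\<close>

fun Wkp :: "nat \<Rightarrow> real \<Rightarrow> 'a set \<Rightarrow> ('a::euclidean_space \<Rightarrow> 'b::euclidean_space) set" where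
  "Wkp 0 p U = Lp p U"
| "Wkp (Suc k) p U = {f \<in> Lp p U. \<forall>i\<in>Basis.
     (\<exists>g. has_weak_partial U i f g) \<and> weak_partial U i f \<in> Wkp k p U}"

fun Wkp_norm :: "nat \<Rightarrow> real \<Rightarrow> 'a set \<Rightarrow> ('a::euclidean_space \<Rightarrow> 'b::euclidean_space) \<Rightarrow> real" where
  "Wkp_norm 0 p U f = Lp_norm p U f"
| "Wkp_norm (Suc k) p U f = Lp_norm p U f + (\<Sum>i\<in>Basis. Wkp_norm k p U (weak_partial U i f))"

definition Wkp0 :: "nat \<Rightarrow> real \<Rightarrow> 'a set \<Rightarrow> ('a::euclidean_space \<Rightarrow> 'b::euclidean_space) set" where
  "Wkp0 k p U = {f \<in> Wkp k p U. \<exists>\<phi>. (\<forall>n::nat. test_fun U (\<phi> n)) \<and>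
     (\<lambda>n. Wkp_norm k p U (\<lambda>x. f x - \<phi> n x)) \<longlonglongrightarrow> 0}"

text \<open>Traces on the face \<open>{x \<in> cbox a b. x \<bullet> i = s}\<close> of a box (\<open>i \<in> Basis\<close>, \<open>s \<in> {a \<bullet> i, b \<bullet> i}\<close>),
  in the sense of the trace operator $W^{1,1} \to L^1$, the continuous extension of the restriction
  of smooth functions. For \<open>h\<close> on the face, the $L^1(\mathrm{cbox}\ a\ b)$ norm of
  \<open>h \<circ> face_proj i s\<close> is the $L^1$ norm of \<open>h\<close> for the surface measure times the edge length
  \<open>(b - a) \<bullet> i\<close>; values of \<open>h\<close> off the face are irrelevant.\<close>

definition face_proj :: "'a \<Rightarrow> real \<Rightarrow> 'a::euclidean_space \<Rightarrow> 'a" where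
  "face_proj i s x = x + (s - x \<bullet> i) *\<^sub>R i"

definition has_face_trace ::
  "'a \<Rightarrow> 'a \<Rightarrow> 'a \<Rightarrow> real \<Rightarrow> ('a::euclidean_space \<Rightarrow> 'b::euclidean_space) \<Rightarrow> ('a \<Rightarrow> 'b) \<Rightarrow> bool" where
  "has_face_trace a b i s f h \<longleftrightarrow>
     f \<in> Wkp 1 1 (box a b) \<and> h \<circ> face_proj i s \<in> Lp 1 (cbox a b) \<and>
     (\<exists>\<phi>. (\<forall>n::nat. smooth (\<phi> n)) \<and>
       (\<lambda>n. Wkp_norm 1 1 (box a b) (\<lambda>x. f x - \<phi> n x)) \<longlonglongrightarrow> 0 \<and>
       (\<lambda>n. Lp_norm 1 (cbox a b) (\<lambda>x. h (face_proj i s x) - \<phi> n (face_proj i s x))) \<longlonglongrightarrow> 0)"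

definition function_space :: "('a \<Rightarrow> 'b::real_vector) set \<Rightarrow> bool" where
  "function_space V \<longleftrightarrow> (\<lambda>_. 0) \<in> V \<and>
     (\<forall>f\<in>V. \<forall>g\<in>V. \<forall>a b. (\<lambda>x. a *\<^sub>R f x + b *\<^sub>R g x) \<in> V)"

section \<open>Matrix fields\<close>

text \<open>A matrix is a function of two basis vectors; \<open>vgrad U u x i j\<close> is $\partial_j u_i(x)$.\<close>

type_synonym 'a matrix = "'a \<Rightarrow> 'a \<Rightarrow> real"

definition vgrad :: "'a set \<Rightarrow> ('a::euclidean_space \<Rightarrow> 'a) \<Rightarrow> 'a \<Rightarrow> 'a matrix" where
  "vgrad U u x = (\<lambda>i j. weak_partial U j u x \<bullet> i)"

definition frob :: "'a::euclidean_space matrix \<Rightarrow> 'a matrix \<Rightarrow> real" where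
  "frob A B = (\<Sum>i\<in>Basis. \<Sum>j\<in>Basis. A i j * B i j)"

definition sym_part :: "'a matrix \<Rightarrow> 'a matrix" where
  "sym_part G = (\<lambda>i j. (G i j + G j i) / 2)"

text \<open>The trace of the gradient is the divergence.\<close>

definition stress :: "real \<Rightarrow> real \<Rightarrow> 'a::euclidean_space matrix \<Rightarrow> 'a matrix" where
  "stress \<mu> lam G =
     (\<lambda>i j. 2 * \<mu> * sym_part G i j + lam * (\<Sum>l\<in>Basis. G l l) * (if i = j then 1 else 0))"

section \<open>The semi-discrete scheme\<close>

text \<open>With $d = \mathrm{CARD}('n) + 1$, points of $\mathbb R^d$ are pairs $(r, x_d)$.\<close>

type_synonym 'n pt = "(real ^ 'n) \<times> real"

locale fsi =
  fixes H :: real and L :: "real ^ 'n::finite" and T :: real and N :: nat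
    and \<eta> :: "nat \<Rightarrow> real ^ 'n \<Rightarrow> real"
    and \<rho> :: "nat \<Rightarrow> 'n pt \<Rightarrow> real"
    and u :: "nat \<Rightarrow> 'n pt \<Rightarrow> 'n pt"
begin

definition tau :: real where "tau = T / real N"

definition I :: "nat \<Rightarrow> real set" where "I k = {real k * tau ..< real (Suc k) * tau}"

definition Sig :: "(real ^ 'n) set" where "Sig = cbox 0 L"

definition Omega_hat :: "'n pt set" where "Omega_hat = Sig \<times> {0..H}"

definition A :: "nat \<Rightarrow> 'n pt \<Rightarrow> 'n pt" where
  "A k = (\<lambda>(r, y). (r, y * ((H + \<eta> k r) / H)))"

definition Omega :: "nat \<Rightarrow> 'n pt set" where "Omega k = A k ` Omega_hat"

text \<open>\<open>X k\<close> is $X_k^{k-1}$ and \<open>F k\<close> is $\mathcal F_k^{k-1}$.\<close>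

definition X :: "nat \<Rightarrow> 'n pt \<Rightarrow> 'n pt" where
  "X k = A (k - 1) \<circ> the_inv_into Omega_hat (A k)"

definition F :: "nat \<Rightarrow> 'n pt \<Rightarrow> real" where
  "F k x = (H + \<eta> (k - 1) (fst x)) / (H + \<eta> k (fst x))"

definition delta_t :: "(nat \<Rightarrow> 'x \<Rightarrow> real) \<Rightarrow> nat \<Rightarrow> 'x \<Rightarrow> real" where
  "delta_t r k x = (r k x - r (k - 1) x) / tau"

definition D_t :: "(nat \<Rightarrow> 'n pt \<Rightarrow> 'b::real_vector) \<Rightarrow> nat \<Rightarrow> 'n pt \<Rightarrow> 'b" where
  "D_t r k x = (1 / tau) *\<^sub>R (r k x - F k x *\<^sub>R r (k - 1) (X k x))"

definition z :: "nat \<Rightarrow> real ^ 'n \<Rightarrow> real" where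
  "z k = (if k = 0 then (\<lambda>_. 0) else delta_t \<eta> k)"

definition w :: "nat \<Rightarrow> 'n pt \<Rightarrow> 'n pt" where
  "w k x = (0, z k (fst x) * (snd x / (H + \<eta> k (fst x))))"

definition v :: "nat \<Rightarrow> 'n pt \<Rightarrow> 'n pt" where "v k x = u k x - w k x"

definition time_avg :: "(real \<Rightarrow> 'x \<Rightarrow> 'b::euclidean_space) \<Rightarrow> nat \<Rightarrow> 'x \<Rightarrow> 'b" where
  "time_avg h k x = (1 / tau) *\<^sub>R (LINT t:I k|lebesgue. h t x)"

text \<open>At \<open>t = T\<close> this is \<open>\<eta> N\<close>.\<close>

definition eta_tau :: "real \<Rightarrow> real ^ 'n \<Rightarrow> real" where
  "eta_tau t = \<eta> (THE k. t \<in> I k)"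

definition e_d :: "'n pt" where "e_d = (0, 1)"

text \<open>Boundary conditions on $\partial\Omega^k$ are imposed on the functions pulled back by
  $\mathcal A^k$ to the faces of $\widehat\Omega$: the top face is mapped to $\Gamma_S$, the
  other ones to $\Gamma_D$.\<close>

definition faces :: "('n pt \<times> real) set" where
  "faces = {(i, s). i \<in> Basis \<and> s \<in> {0, (L, H) \<bullet> i}}"

definition equal_on_boundary :: "nat \<Rightarrow> ('n pt \<Rightarrow> 'n pt) \<Rightarrow> ('n pt \<Rightarrow> 'n pt) \<Rightarrow> bool" where
  "equal_on_boundary k f h \<longleftrightarrow>
     (\<forall>(i, s)\<in>faces. has_face_trace 0 (L, H) i s (f \<circ> A k) (h \<circ> A k))"

definition compatible :: "nat \<Rightarrow> (real ^ 'n \<Rightarrow> real) \<Rightarrow> ('n pt \<Rightarrow> 'n pt) \<Rightarrow> bool" where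
  "compatible k \<psi> \<Psi> \<longleftrightarrow>
     has_face_trace 0 (L, H) e_d H (\<Psi> \<circ> A k) (\<lambda>x. \<psi> (fst x) *\<^sub>R e_d) \<and>
     (\<forall>(i, s)\<in>faces - {(e_d, H)}. has_face_trace 0 (L, H) i s (\<Psi> \<circ> A k) (\<lambda>_. 0))"

text \<open>Row-wise divergence: the component along \<open>i\<close> of $\mathrm{div}(\varrho u\otimes v)$ is
  $\mathrm{div}(\varrho u_i v)$.\<close>

definition div_mass :: "nat \<Rightarrow> 'n pt \<Rightarrow> real" where
  "div_mass k = weak_div (interior (Omega k)) (\<lambda>x. \<rho> k x *\<^sub>R v k x)"

definition div_momentum :: "nat \<Rightarrow> 'n pt \<Rightarrow> 'n pt" where
  "div_momentum k x =
     (\<Sum>i\<in>Basis. weak_div (interior (Omega k)) (\<lambda>y. (\<rho> k y * (u k y \<bullet> i)) *\<^sub>R v k y) x *\<^sub>R i)"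

text \<open>The real number \<open>c\<close> bounds all the quantities controlled by the energy inequality
  (whose finiteness is part of the claim).\<close>

definition energy_bounds :: "real \<Rightarrow> real \<Rightarrow> real \<Rightarrow> real \<Rightarrow> bool" where
  "energy_bounds \<alpha> \<beta> \<gamma> c \<longleftrightarrow>
     (\<forall>k\<in>{1..N}.
        \<rho> k \<in> Lp \<gamma> (Omega k) \<and> Lp_norm \<gamma> (Omega k) (\<rho> k) \<le> c \<and>
        (\<lambda>x. \<rho> k x * (norm (u k x))\<^sup>2) \<in> Lp 1 (Omega k) \<and>
        Lp_norm 1 (Omega k) (\<lambda>x. \<rho> k x * (norm (u k x))\<^sup>2) \<le> c \<and>
        u k \<in> Lp 6 (Omega k) \<and>
        (\<lambda>x. sqrt (frob (vgrad (interior (Omega k)) (u k) x) (vgrad (interior (Omega k)) (u k) x)))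
          \<in> Lp 2 (Omega k) \<and>
        z k \<in> Lp 2 Sig \<and> Lp_norm 2 Sig (z k) \<le> c \<and>
        weak_laplacian (interior Sig) (\<eta> k) \<in> Lp 2 Sig \<and>
        \<alpha> * Lp_norm 2 Sig (weak_laplacian (interior Sig) (\<eta> k)) \<le> c \<and>
        weak_grad (interior Sig) (\<eta> k) \<in> Lp 2 Sig \<and>
        \<beta> * Lp_norm 2 Sig (weak_grad (interior Sig) (\<eta> k)) \<le> c) \<and>
     (\<Sum>k=1..N. tau * (Lp_norm 6 (Omega k) (u k))\<^sup>2) \<le> c \<and>
     (\<Sum>k=1..N. tau * (Lp_norm 2 (Omega k) (\<lambda>x.
         sqrt (frob (vgrad (interior (Omega k)) (u k) x) (vgrad (interior (Omega k)) (u k) x))))\<^sup>2) \<le> c"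

end

text \<open>\<open>W\<close>, \<open>Q\<close>, \<open>V\<close> are the spaces $W(\Sigma)$, $Q(\Omega^k)$, $V(\Omega^k)$; elements are functions,
  not equivalence classes, and \<open>\<eta> k\<close> is the continuous representative. The assumptions named
  \<open>regular_*\<close> say that every expression in the two equations is well defined: the
  weak divergences exist and the integrands are integrable. No sign is imposed on \<open>\<rho> k\<close> for
  \<open>k \<ge> 1\<close>; where \<open>\<rho> k\<close> is negative the value of \<open>powr\<close> in the pressure is a mere convention.\<close>

locale semidiscrete_solution = fsi H L T N \<eta> \<rho> u
  for H :: real and L :: "real ^ 'n::finite" and T :: real and N :: nat
    and \<eta> :: "nat \<Rightarrow> real ^ 'n \<Rightarrow> real"
    and \<rho> :: "nat \<Rightarrow> 'n pt \<Rightarrow> real"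
    and u :: "nat \<Rightarrow> 'n pt \<Rightarrow> 'n pt" +
  fixes a \<gamma> \<mu> lam \<alpha> \<beta> :: real
    and f :: "real \<Rightarrow> 'n pt \<Rightarrow> 'n pt" and g :: "real \<Rightarrow> real ^ 'n \<Rightarrow> real"
    and \<rho>0 :: "'n pt \<Rightarrow> real" and u0 :: "'n pt \<Rightarrow> 'n pt"
    and W :: "(real ^ 'n \<Rightarrow> real) set"
    and Q :: "'n pt set \<Rightarrow> ('n pt \<Rightarrow> real) set"
    and V :: "'n pt set \<Rightarrow> ('n pt \<Rightarrow> 'n pt) set"
  assumes dimension: "CARD('n) + 1 \<in> {2, 3}"
    and geometry: "H > 0" "\<And>i. L $ i > 0"
    and time_grid: "T > 0" "N \<ge> 1"
    and parameters: "a > 0" "\<gamma> > 1" "\<mu> > 0" "\<mu> + lam \<ge> 0" "\<alpha> > 0" "\<beta> \<ge> 0"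
    and W_space: "function_space W" "W \<subseteq> Wkp0 2 2 (interior Sig)"
    and Q_space: "\<And>k. k \<in> {1..N} \<Longrightarrow> function_space (Q (Omega k)) \<and> Q (Omega k) \<subseteq> Lp \<gamma> (Omega k)"
    and V_space: "\<And>k. k \<in> {1..N} \<Longrightarrow> function_space (V (Omega k)) \<and>
        (\<forall>s\<in>{1..<2}. V (Omega k) \<subseteq> Wkp 1 s (interior (Omega k)))"
    and displacement: "\<And>k r. k \<le> N \<Longrightarrow> r \<in> Sig \<Longrightarrow> \<eta> k r > - H"
        "\<And>k. k \<le> N \<Longrightarrow> continuous_on Sig (\<eta> k)"
    and initial: "\<And>r. r \<in> Sig \<Longrightarrow> \<eta> 0 r = 0"
        "\<rho> 0 = \<rho>0" "\<And>x. x \<in> Omega 0 \<Longrightarrow> \<rho>0 x \<ge> 0" "u 0 = u0"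
    and solution_in: "\<And>k. k \<in> {1..N} \<Longrightarrow> \<eta> k \<in> W \<and> \<rho> k \<in> Q (Omega k) \<and> u k \<in> V (Omega k)"
    and boundary: "\<And>k. k \<in> {1..N} \<Longrightarrow> equal_on_boundary k (u k) (w k)"
    and regular_data: "\<And>k. k \<in> {1..N} \<Longrightarrow>
          (AE x in lebesgue. x \<in> Omega k \<longrightarrow> set_integrable lebesgue (I k) (\<lambda>t. f t x)) \<and>
          (AE r in lebesgue. r \<in> Sig \<longrightarrow> set_integrable lebesgue (I k) (\<lambda>t. g t r))"
    and regular_div: "\<And>k. k \<in> {1..N} \<Longrightarrow>
          (\<exists>q. has_weak_div (interior (Omega k)) (\<lambda>x. \<rho> k x *\<^sub>R v k x) q) \<and>
          (\<forall>i\<in>Basis. \<exists>q. has_weak_div (interior (Omega k))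
                            (\<lambda>x. (\<rho> k x * (u k x \<bullet> i)) *\<^sub>R v k x) q)"
    and regular_mass: "\<And>k \<phi>. k \<in> {1..N} \<Longrightarrow> \<phi> \<in> Q (Omega k) \<Longrightarrow>
          set_integrable lebesgue (Omega k) (\<lambda>x. D_t \<rho> k x * \<phi> x) \<and>
          set_integrable lebesgue (Omega k) (\<lambda>x. div_mass k x * \<phi> x)"
    and mass: "\<And>k \<phi>. k \<in> {1..N} \<Longrightarrow> \<phi> \<in> Q (Omega k) \<Longrightarrow>
          (LINT x:Omega k|lebesgue. D_t \<rho> k x * \<phi> x)
          + (LINT x:Omega k|lebesgue. div_mass k x * \<phi> x) = 0"
    and regular_momentum: "\<And>k \<psi> \<Psi>. k \<in> {1..N} \<Longrightarrow> \<psi> \<in> W \<Longrightarrow> \<Psi> \<in> V (Omega k) \<Longrightarrow> compatible k \<psi> \<Psi> \<Longrightarrow>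
          set_integrable lebesgue (Omega k)
            (\<lambda>x. (D_t (\<lambda>j y. \<rho> j y *\<^sub>R u j y) k x + div_momentum k x) \<bullet> \<Psi> x) \<and>
          set_integrable lebesgue (Omega k)
            (\<lambda>x. frob (stress \<mu> lam (vgrad (interior (Omega k)) (u k) x))
                      (vgrad (interior (Omega k)) \<Psi> x)) \<and>
          set_integrable lebesgue (Omega k)
            (\<lambda>x. a * \<rho> k x powr \<gamma> * weak_div (interior (Omega k)) \<Psi> x) \<and>
          set_integrable lebesgue Sig (\<lambda>r. delta_t z k r * \<psi> r) \<and>
          set_integrable lebesgue Sig
            (\<lambda>r. weak_laplacian (interior Sig) (\<eta> k) r * weak_laplacian (interior Sig) \<psi> r) \<and>
          set_integrable lebesgue Sig
            (\<lambda>r. weak_grad (interior Sig) (\<eta> k) r \<bullet> weak_grad (interior Sig) \<psi> r) \<and>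
          set_integrable lebesgue (Omega k) (\<lambda>x. \<rho> k x * (time_avg f k x \<bullet> \<Psi> x)) \<and>
          set_integrable lebesgue Sig (\<lambda>r. time_avg g k r * \<psi> r)"
    and momentum: "\<And>k \<psi> \<Psi>. k \<in> {1..N} \<Longrightarrow> \<psi> \<in> W \<Longrightarrow> \<Psi> \<in> V (Omega k) \<Longrightarrow> compatible k \<psi> \<Psi> \<Longrightarrow>
          (LINT x:Omega k|lebesgue.
              (D_t (\<lambda>j y. \<rho> j y *\<^sub>R u j y) k x + div_momentum k x) \<bullet> \<Psi> x)
          + (LINT x:Omega k|lebesgue.
              frob (stress \<mu> lam (vgrad (interior (Omega k)) (u k) x))
                   (vgrad (interior (Omega k)) \<Psi> x))
          - (LINT x:Omega k|lebesgue. a * \<rho> k x powr \<gamma> * weak_div (interior (Omega k)) \<Psi> x)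
          + (LINT r:Sig|lebesgue. delta_t z k r * \<psi> r)
          + \<alpha> * (LINT r:Sig|lebesgue.
              weak_laplacian (interior Sig) (\<eta> k) r * weak_laplacian (interior Sig) \<psi> r)
          + \<beta> * (LINT r:Sig|lebesgue.
              weak_grad (interior Sig) (\<eta> k) r \<bullet> weak_grad (interior Sig) \<psi> r)
          = (LINT x:Omega k|lebesgue. \<rho> k x * (time_avg f k x \<bullet> \<Psi> x))
          + (LINT r:Sig|lebesgue. time_avg g k r * \<psi> r)"

end

theory Submission
  imports Defs
begin

text \<open>The displacement can only approach the bottom of the container by becoming large, and it cannot become
large quickly. Indeed $\eta^0=0$ and $\eta^k=\eta^{k-1}+\tau z^k$, so the bound on $\|z^k\|_{L^2(\Sigma)}$
makes $\|\eta^k\|_{L^2(\Sigma)}\le c\,t^k$ small for small times (\<open>eta_L2_le\<close>), while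
$\|\Delta\eta^k\|_{L^2(\Sigma)}\le c/\alpha$ stays bounded. Since $\Sigma$ has dimension one or two, point
values are controlled by an interpolation between these two norms,
$$|\eta|^4\le 9\,a^2b\,(a+b),\qquad a=\|\eta\|_{L^2(\Sigma)},\quad b=\|\Delta\eta\|_{L^2(\Sigma)},$$
valid for continuous $\eta\in W^{2,2}_0(\Sigma)$ (\<open>Wkp0_sup_le_L2_weak_laplacian\<close>). The
constant is absolute, hence independent of $\Sigma$, because functions in $W^{2,2}_0$ are limits of test
functions and these live on the whole space.

For a test function $\phi$ the inequality comes from the embedding
$|F(x)|\le\int|\partial_1\cdots\partial_nF|$ (\<open>abs_le_integral_mixed_partial\<close>) applied to
$F=\phi^2$. First derivatives are then handled by $\|\nabla\phi\|^2=-\int\phi\Delta\phi\le ab$, and the mixed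
second derivative by $\int(\partial_j\partial_i\phi)^2=\int\partial_{ii}\phi\,\partial_{jj}\phi$, which bounds it by
$\|\Delta\phi\|$ (\<open>sup_le_L2_laplacian\<close>).

Passing from test functions to $W^{2,2}_0$ requires that weak derivatives be unique up to null sets,
for otherwise convergence of the Sobolev norms would say nothing about the weak Laplacian of the
limit. Uniqueness is the fundamental lemma of the calculus of variations, proved here with bump functions
built from $e^{-1/t}$.\<close>

section \<open>Calculus of smooth functions and test functions\<close>

lemma partial_eqI: "(f has_derivative f') (at x) \<Longrightarrow> partial i f x = f' i"
  unfolding partial_def by (simp add: frechet_derivative_at[symmetric])

lemma Ck_Suc_imp_Ck: "Ck (Suc k) f \<Longrightarrow> Ck k f"
proof (induction k arbitrary: f)
  case 0
  then show ?case
    by (auto intro!: continuous_at_imp_continuous_on differentiable_imp_continuous_within)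
next
  case (Suc k)
  then show ?case by (metis Ck.simps(2))
qed

lemma Ck_imp_continuous: "Ck k f \<Longrightarrow> continuous_on UNIV f"
  by (induction k) (use Ck_Suc_imp_Ck in auto)

lemma partial_mult:
  fixes f g :: "'a::euclidean_space \<Rightarrow> real"
  assumes "f differentiable (at x)" "g differentiable (at x)"
  shows "partial i (\<lambda>x. f x * g x) x = partial i f x * g x + f x * partial i g x"
proof -
  have "((\<lambda>x. f x * g x) has_derivative
      (\<lambda>h. f x * frechet_derivative g (at x) h + frechet_derivative f (at x) h * g x)) (at x)"
    using assms by (intro has_derivative_mult) (simp_all add: frechet_derivative_works)
  from partial_eqI[OF this, of i] show ?thesis by (simp add: partial_def)
qed

lemma partial_add:
  assumes "f differentiable (at x)" "g differentiable (at x)"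
  shows "partial i (\<lambda>x. f x + g x) x = partial i f x + partial i g x"
proof -
  have "((\<lambda>x. f x + g x) has_derivative
      (\<lambda>h. frechet_derivative f (at x) h + frechet_derivative g (at x) h)) (at x)"
    using assms by (intro has_derivative_add) (simp_all add: frechet_derivative_works)
  from partial_eqI[OF this, of i] show ?thesis by (simp add: partial_def)
qed

lemma Ck_add: "Ck k f \<Longrightarrow> Ck k g \<Longrightarrow> Ck k (\<lambda>x. f x + g x)"
proof (induction k arbitrary: f g)
  case 0
  then show ?case by (auto intro: continuous_intros)
next
  case (Suc k)
  then have "partial i (\<lambda>x. f x + g x) = (\<lambda>x. partial i f x + partial i g x)" for i
    by (auto simp: partial_add)
  with Suc show ?case by auto
qed

lemma Ck_mult:
  fixes f g :: "'a::euclidean_space \<Rightarrow> real"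
  shows "Ck k f \<Longrightarrow> Ck k g \<Longrightarrow> Ck k (\<lambda>x. f x * g x)"
proof (induction k arbitrary: f g)
  case 0
  then show ?case by (auto intro: continuous_intros)
next
  case (Suc k)
  then have "partial i (\<lambda>x. f x * g x) = (\<lambda>x. partial i f x * g x + f x * partial i g x)" for i
    by (auto simp: partial_mult)
  with Suc show ?case
    by (auto intro!: Ck_add Suc.IH Ck_Suc_imp_Ck[of k f] Ck_Suc_imp_Ck[of k g])
qed

lemma Ck_const: "Ck k (\<lambda>x. c)"
proof (induction k arbitrary: c)
  case (Suc k)
  have "partial i (\<lambda>x. c) = (\<lambda>x. 0)" for i :: 'a
    by (auto intro!: partial_eqI derivative_eq_intros)
  with Suc show ?case by auto
qed auto

lemma Ck_prod:
  fixes f :: "'i \<Rightarrow> 'a::euclidean_space \<Rightarrow> real"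
  shows "(\<And>i. i \<in> S \<Longrightarrow> Ck k (f i)) \<Longrightarrow> Ck k (\<lambda>x. \<Prod>i\<in>S. f i x)"
  by (induction S rule: infinite_finite_induct) (auto simp: Ck_const Ck_mult)

lemma Ck_sum: "(\<And>i. i \<in> S \<Longrightarrow> Ck k (f i)) \<Longrightarrow> Ck k (\<lambda>x. \<Sum>i\<in>S. f i x)"
  by (induction S rule: infinite_finite_induct) (auto simp: Ck_const Ck_add)

lemma smooth_imp_differentiable: "smooth f \<Longrightarrow> f differentiable (at x)"
  unfolding smooth_def by (metis Ck.simps(2))

lemma smooth_imp_continuous_on: "smooth f \<Longrightarrow> continuous_on S f"
  unfolding smooth_def using Ck_imp_continuous continuous_on_subset by blast

lemma smooth_partial: "smooth f \<Longrightarrow> i \<in> Basis \<Longrightarrow> smooth (partial i f)"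
  unfolding smooth_def by (metis Ck.simps(2))

lemma smooth_mult: "smooth f \<Longrightarrow> smooth g \<Longrightarrow> smooth (\<lambda>x. f x * g x)"
  for f g :: "'a::euclidean_space \<Rightarrow> real"
  unfolding smooth_def by (simp add: Ck_mult)

lemma partial_translate:
  assumes "f differentiable (at (x + c))"
  shows "partial i (\<lambda>x. f (x + c)) x = partial i f (x + c)"
proof -
  have "(f has_derivative frechet_derivative f (at (x + c))) (at (x + c))"
    using assms by (simp add: frechet_derivative_works)
  moreover have "((\<lambda>x. x + c) has_derivative (\<lambda>h. h)) (at x)"
    by (auto intro!: derivative_eq_intros)
  ultimately have "((\<lambda>x. f (x + c)) has_derivative (\<lambda>h. frechet_derivative f (at (x + c)) h)) (at x)"
    using has_derivative_compose by blast
  from partial_eqI[OF this, of i] show ?thesis by (simp add: partial_def)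
qed

lemma Ck_translate: "Ck k f \<Longrightarrow> Ck k (\<lambda>x. f (x + c))"
proof (induction k arbitrary: f)
  case 0
  then have "continuous_on UNIV (\<lambda>x. f (x + c))"
    using continuous_on_compose2[of UNIV f UNIV "\<lambda>x. x + c"] by (simp add: continuous_on_add)
  then show ?case by simp
next
  case (Suc k)
  then have "partial i (\<lambda>x. f (x + c)) = (\<lambda>x. partial i f (x + c))" for i
    by (intro ext partial_translate) simp
  moreover have "(\<lambda>x. f (x + c)) differentiable (at x)" for x
    using Suc.prems differentiable_chain_at[of "\<lambda>x. x + c" x f] by (simp add: o_def)
  ultimately show ?case using Suc by auto
qed

lemma smooth_translate: "smooth f \<Longrightarrow> smooth (\<lambda>x. f (x + c))"
  by (simp add: smooth_def Ck_translate)

lemma smooth_has_derivative_line: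
  assumes "smooth f"
  shows "((\<lambda>t. f (x + t *\<^sub>R i)) has_vector_derivative partial i f (x + t *\<^sub>R i)) (at t within S)"
proof -
  have "(f has_derivative frechet_derivative f (at (x + t *\<^sub>R i))) (at (x + t *\<^sub>R i))"
    using smooth_imp_differentiable[OF assms] by (simp add: frechet_derivative_works)
  moreover have "((\<lambda>t. x + t *\<^sub>R i) has_derivative (\<lambda>h. h *\<^sub>R i)) (at t within S)"
    by (auto intro!: derivative_eq_intros)
  ultimately have "((\<lambda>t. f (x + t *\<^sub>R i)) has_derivative
      (\<lambda>h. frechet_derivative f (at (x + t *\<^sub>R i)) (h *\<^sub>R i))) (at t within S)"
    using has_derivative_compose by blast
  moreover have "linear (frechet_derivative f (at (x + t *\<^sub>R i)))"
    using smooth_imp_differentiable[OF assms] linear_frechet_derivative by blast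
  ultimately show ?thesis
    by (simp add: has_vector_derivative_def partial_def linear_scale)
qed

lemma test_funD:
  assumes "test_fun U \<phi>"
  shows "smooth \<phi>" "x \<notin> U \<Longrightarrow> \<phi> x = 0"
proof -
  show "smooth \<phi>" using assms by (simp add: test_fun_def)
  show "\<phi> x = 0" if "x \<notin> U"
  proof (rule ccontr)
    assume "\<phi> x \<noteq> 0"
    then have "x \<in> closure {x. \<phi> x \<noteq> 0}" by (intro subsetD[OF closure_subset]) simp
    with assms that show False unfolding test_fun_def by fast
  qed
qed

lemma zero_outside_support:
  assumes "y \<in> - closure {x. \<phi> x \<noteq> 0}"
  shows "\<phi> y = 0"
proof (rule ccontr)
  assume "\<phi> y \<noteq> 0"
  then have "y \<in> closure {x. \<phi> x \<noteq> 0}" by (intro subsetD[OF closure_subset]) simp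
  with assms show False by simp
qed

text \<open>The usual way to produce new test functions: whatever vanishes outside the support of a test
function inherits its compact support.\<close>

lemma test_fun_support_subset:
  assumes "test_fun U \<phi>" "smooth \<psi>" "{x. \<psi> x \<noteq> 0} \<subseteq> closure {x. \<phi> x \<noteq> 0}"
  shows "test_fun U \<psi>"
proof -
  have "closure {x. \<psi> x \<noteq> 0} \<subseteq> closure {x. \<phi> x \<noteq> 0}"
    using assms(3) by (simp add: closure_minimal)
  moreover from this have "compact (closure {x. \<psi> x \<noteq> 0})"
    using assms(1) by (metis bounded_subset closed_closure compact_eq_bounded_closed test_fun_def)
  ultimately show ?thesis
    using assms(1,2) order_trans unfolding test_fun_def by fast
qed

lemma test_fun_partial:
  assumes "test_fun U \<phi>" "i \<in> Basis"
  shows "test_fun U (partial i \<phi>)"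
proof (rule test_fun_support_subset[OF assms(1)])
  show "smooth (partial i \<phi>)" using assms smooth_partial test_funD by blast
  show "{x. partial i \<phi> x \<noteq> 0} \<subseteq> closure {x. \<phi> x \<noteq> 0}"
  proof (clarify, rule ccontr)
    fix x assume x: "partial i \<phi> x \<noteq> 0" "x \<notin> closure {x. \<phi> x \<noteq> 0}"
    have "(\<phi> has_derivative (\<lambda>_. 0)) (at x)"
    proof (rule has_derivative_transform_within_open)
      show "((\<lambda>_. 0) has_derivative (\<lambda>_. 0)) (at x)" by simp
      show "open (- closure {x. \<phi> x \<noteq> 0})" by blast
      show "x \<in> - closure {x. \<phi> x \<noteq> 0}" using x by blast
      show "0 = \<phi> y" if "y \<in> - closure {x. \<phi> x \<noteq> 0}" for y
        using zero_outside_support[OF that] by (rule sym)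
    qed
    from partial_eqI[OF this] x show False by auto
  qed
qed

lemma test_fun_mult:
  fixes \<phi> \<psi> :: "'a::euclidean_space \<Rightarrow> real"
  assumes "test_fun U \<phi>" "smooth \<psi>"
  shows "test_fun U (\<lambda>x. \<phi> x * \<psi> x)"
  by (rule test_fun_support_subset[OF assms(1) smooth_mult[OF test_funD(1)[OF assms(1)] assms(2)]])
     (rule order_trans[OF _ closure_subset], auto)

lemma continuous_compact_support_integrable:
  fixes f :: "'a::euclidean_space \<Rightarrow> 'b::euclidean_space"
  assumes "continuous_on UNIV f" "compact K" "\<And>x. x \<notin> K \<Longrightarrow> f x = 0"
  shows "integrable lborel f"
proof -
  have "integrable lborel (\<lambda>x. indicator K x *\<^sub>R f x)"
    using assms borel_integrable_compact continuous_on_subset by blast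
  moreover have "(\<lambda>x. indicator K x *\<^sub>R f x) = f"
    using assms(3) by (auto simp: indicator_def fun_eq_iff)
  ultimately show ?thesis by simp
qed

lemma test_fun_compact_support:
  assumes "test_fun U \<phi>"
  obtains K where "compact K" "K \<subseteq> U" "\<And>x. x \<notin> K \<Longrightarrow> \<phi> x = 0"
proof (rule that)
  show "compact (closure {x. \<phi> x \<noteq> 0})" "closure {x. \<phi> x \<noteq> 0} \<subseteq> U"
    using assms by (auto simp: test_fun_def)
  show "\<phi> x = 0" if "x \<notin> closure {x. \<phi> x \<noteq> 0}" for x
    using that by (intro zero_outside_support) simp
qed

lemma test_fun_integrable:
  fixes \<phi> :: "'a::euclidean_space \<Rightarrow> real"
  assumes "test_fun U \<phi>" "continuous_on UNIV g"
  shows "integrable lborel (\<lambda>x. \<phi> x * g x)"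
proof -
  obtain K where "compact K" "K \<subseteq> U" "\<And>x. x \<notin> K \<Longrightarrow> \<phi> x = 0"
    by (rule test_fun_compact_support[OF assms(1)]) (rule that)
  then show ?thesis
    by (intro continuous_compact_support_integrable[where K=K] continuous_intros assms
        smooth_imp_continuous_on[OF test_funD(1)[OF assms(1)]]) auto
qed

lemma test_fun_bounded:
  fixes \<phi> :: "'a::euclidean_space \<Rightarrow> real"
  assumes "test_fun U \<phi>"
  obtains B where "\<And>x. \<bar>\<phi> x\<bar> \<le> B"
proof -
  obtain K where K: "compact K" "K \<subseteq> U" "\<And>x. x \<notin> K \<Longrightarrow> \<phi> x = 0"
    by (rule test_fun_compact_support[OF assms]) (rule that)
  have "compact (\<phi> ` K)"
    using K smooth_imp_continuous_on[OF test_funD(1)[OF assms]] compact_continuous_image by blast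
  then obtain B where B: "\<And>x. x \<in> K \<Longrightarrow> \<bar>\<phi> x\<bar> \<le> B"
    using compact_imp_bounded by (force simp: bounded_iff)
  show ?thesis
    by (rule that[of "max B 0"]) (metis B K(3) abs_zero max.coboundedI1 max.coboundedI2 order_refl)
qed

section \<open>Integration by parts\<close>

text \<open>Partial derivatives are treated through difference quotients, because these are built from
translations: the Lebesgue integral is translation invariant, and translations commute with
differentiation. The two facts give integration by parts and the symmetry of second derivatives
without iterated integrals. By the mean value theorem the quotients are bounded by the maximum of
the derivative, and they all vanish outside one compact set, so dominated convergence applies.\<close>

lemma integral_difference_quotient_tendsto:
  fixes \<phi> g :: "'a::euclidean_space \<Rightarrow> real"
  assumes \<phi>: "test_fun U \<phi>" and i: "i \<in> Basis" and g: "continuous_on UNIV g"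
  shows "(\<lambda>n. \<integral>x. real (Suc n) * (\<phi> (x + (1 / real (Suc n)) *\<^sub>R i) - \<phi> x) * g x \<partial>lborel)
    \<longlonglongrightarrow> (\<integral>x. partial i \<phi> x * g x \<partial>lborel)"
proof -
  obtain K where K: "compact K" "K \<subseteq> U" "\<And>x. x \<notin> K \<Longrightarrow> \<phi> x = 0"
    by (rule test_fun_compact_support[OF \<phi>]) (rule that)
  \<comment> \<open>Increments have length at most 1, so all difference quotients are supported in the
    1-neighbourhood of the support.\<close>
  define K' where "K' = {x - t | x t. x \<in> K \<and> t \<in> cball 0 1}"
  have K': "compact K'" unfolding K'_def by (intro compact_differences K compact_cball)
  obtain B where B: "\<And>x. \<bar>partial i \<phi> x\<bar> \<le> B"
    using test_fun_bounded[OF test_fun_partial[OF \<phi> i]] by blast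
  have sm: "smooth \<phi>" using \<phi> test_funD by blast
  have sml: "continuous_on UNIV (\<phi>)" "continuous_on UNIV (partial i \<phi>)"
    using sm i smooth_imp_continuous_on smooth_partial by blast+
  have [measurable]: "\<phi> \<in> borel_measurable borel" "partial i \<phi> \<in> borel_measurable borel"
       "g \<in> borel_measurable borel"
    using sml g by (auto intro: borel_measurable_continuous_onI)
  let ?D = "\<lambda>n x. real (Suc n) * (\<phi> (x + (1 / real (Suc n)) *\<^sub>R i) - \<phi> x)"
  have bound: "\<bar>?D n x\<bar> \<le> B * indicator K' x" for n x
  proof (cases "x \<in> K'")
    case False
    define h where "h = 1 / real (Suc n)"
    have "x \<notin> K" using False unfolding K'_def by force
    moreover have "x + h *\<^sub>R i \<notin> K"
    proof
      assume "x + h *\<^sub>R i \<in> K"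
      moreover have "h *\<^sub>R i \<in> cball 0 1" using i by (simp add: h_def)
      moreover have "x = (x + h *\<^sub>R i) - h *\<^sub>R i" by simp
      ultimately have "x \<in> K'" unfolding K'_def by blast
      with False show False by simp
    qed
    ultimately show ?thesis using K False by (simp add: h_def)
  next
    case True
    define h where "h = 1 / real (Suc n)"
    have h: "h > 0" by (simp add: h_def)
    have "\<exists>t. 0 < t \<and> t < h \<and> \<phi> (x + h *\<^sub>R i) - \<phi> (x + 0 *\<^sub>R i) = (h - 0) * partial i \<phi> (x + t *\<^sub>R i)"
      using smooth_has_derivative_line[OF sm, of x i _ UNIV] h
      by (intro MVT2) (auto simp: has_real_derivative_iff_has_vector_derivative)
    then obtain t where "\<phi> (x + h *\<^sub>R i) - \<phi> x = h * partial i \<phi> (x + t *\<^sub>R i)" by auto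
    then have "?D n x = partial i \<phi> (x + t *\<^sub>R i)" by (simp add: h_def)
    with B True show ?thesis by simp
  qed
  have lim: "(\<lambda>n. ?D n x) \<longlonglongrightarrow> partial i \<phi> x" for x
  proof -
    have "((\<lambda>t. \<phi> (x + t *\<^sub>R i)) has_real_derivative partial i \<phi> x) (at 0)"
      using smooth_has_derivative_line[OF sm, of x i 0 UNIV]
      by (simp add: has_real_derivative_iff_has_vector_derivative)
    then have "((\<lambda>h. (\<phi> (x + h *\<^sub>R i) - \<phi> x) / h) \<longlongrightarrow> partial i \<phi> x) (at 0)"
      by (simp add: DERIV_def)
    moreover have "filterlim (\<lambda>n. 1 / real (Suc n)) (at 0) sequentially"
      unfolding filterlim_at using LIMSEQ_Suc[OF lim_1_over_n] by (auto simp: eventually_at_top_linorder)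
    ultimately have "(\<lambda>n. (\<phi> (x + (1 / real (Suc n)) *\<^sub>R i) - \<phi> x) / (1 / real (Suc n))) \<longlonglongrightarrow> partial i \<phi> x"
      by (rule filterlim_compose)
    then show ?thesis by (simp add: mult.commute)
  qed
  show ?thesis
  proof (rule integral_dominated_convergence[where w="\<lambda>x. indicator K' x *\<^sub>R \<bar>B * g x\<bar>"])
    show "integrable lborel (\<lambda>x. indicator K' x *\<^sub>R \<bar>B * g x\<bar>)"
      by (intro borel_integrable_compact K' continuous_intros continuous_on_subset[OF g]) auto
    show "AE x in lborel. (\<lambda>n. ?D n x * g x) \<longlonglongrightarrow> partial i \<phi> x * g x"
      using lim by (auto intro!: tendsto_intros)
    show "AE x in lborel. norm (?D n x * g x) \<le> indicator K' x *\<^sub>R \<bar>B * g x\<bar>" for n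
    proof (rule AE_I2)
      fix x
      have "B \<ge> 0" using B[of x] by linarith
      have "norm (?D n x * g x) \<le> (B * indicator K' x) * \<bar>g x\<bar>"
        unfolding real_norm_def abs_mult[of _ "g x"]
        by (rule mult_right_mono[OF bound]) auto
      also have "\<dots> = indicator K' x *\<^sub>R \<bar>B * g x\<bar>" using \<open>B \<ge> 0\<close> by (simp add: abs_mult)
      finally show "norm (?D n x * g x) \<le> indicator K' x *\<^sub>R \<bar>B * g x\<bar>" .
    qed
  qed measurable
qed

lemma integral_translate:
  fixes f :: "'a::euclidean_space \<Rightarrow> real"
  assumes "f \<in> borel_measurable borel"
  shows "(\<integral>x. f (x + c) \<partial>lborel) = (\<integral>x. f x \<partial>lborel)"
proof -
  have "(\<integral>x. f x \<partial>lborel) = (\<integral>x. f x \<partial>distr lborel borel ((+) c))" by (simp add: lborel_distr_plus)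
  also have "\<dots> = (\<integral>x. f (c + x) \<partial>lborel)" using assms by (subst integral_distr) auto
  finally show ?thesis by (simp add: add.commute)
qed

lemma integrable_translate:
  fixes f :: "'a::euclidean_space \<Rightarrow> real"
  assumes "integrable lborel f"
  shows "integrable lborel (\<lambda>x. f (x + c))"
proof -
  have "integrable (distr lborel borel ((+) c)) f" using assms by (simp add: lborel_distr_plus)
  then have "integrable lborel (\<lambda>x. f (c + x))"
    using assms by (subst (asm) integrable_distr_eq) auto
  then show ?thesis by (simp add: add.commute)
qed

text \<open>The difference quotients have integral zero by translation invariance.\<close>

lemma integral_partial_eq_0:
  fixes \<phi> :: "'a::euclidean_space \<Rightarrow> real"
  assumes "test_fun U \<phi>" "i \<in> Basis"
  shows "(\<integral>x. partial i \<phi> x \<partial>lborel) = 0"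
proof -
  have int: "integrable lborel \<phi>" using test_fun_integrable[OF assms(1), of "\<lambda>_. 1"] by simp
  have "(\<integral>x. real (Suc n) * (\<phi> (x + (1 / real (Suc n)) *\<^sub>R i) - \<phi> x) \<partial>lborel) = 0" for n
    using int integrable_translate[OF int]
    by (simp add: integral_translate)
  with integral_difference_quotient_tendsto[OF assms, of "\<lambda>_. 1"] show ?thesis
    by (simp add: LIMSEQ_const_iff)
qed

lemma integration_by_parts:
  fixes \<phi> \<psi> :: "'a::euclidean_space \<Rightarrow> real"
  assumes "test_fun U \<phi>" "i \<in> Basis" "smooth \<psi>"
  shows "(\<integral>x. partial i \<phi> x * \<psi> x \<partial>lborel) = - (\<integral>x. \<phi> x * partial i \<psi> x \<partial>lborel)"
proof -
  have "(\<integral>x. partial i \<phi> x * \<psi> x + \<phi> x * partial i \<psi> x \<partial>lborel) = 0"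
    using integral_partial_eq_0[OF test_fun_mult[OF assms(1,3)] assms(2)]
    by (simp add: partial_mult smooth_imp_differentiable test_funD(1)[OF assms(1)] assms(3))
  moreover have "integrable lborel (\<lambda>x. partial i \<phi> x * \<psi> x)" "integrable lborel (\<lambda>x. \<phi> x * partial i \<psi> x)"
    using assms by (auto intro!: test_fun_integrable test_fun_partial smooth_imp_continuous_on smooth_partial)
  ultimately show ?thesis by simp
qed

text \<open>Symmetry of second derivatives, tested against a smooth function: differencing in direction
\<open>j\<close> commutes with \<open>partial i\<close>, so both sides are limits of the same
integrals. This tested form is the one that enters the energy identities below, where a pointwise
statement would only be integrated again.\<close>

lemma weak_partial_commute:
  fixes \<phi> \<psi> :: "'a::euclidean_space \<Rightarrow> real"
  assumes \<phi>: "test_fun U \<phi>" and ij: "i \<in> Basis" "j \<in> Basis" and \<psi>: "smooth \<psi>"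
  shows "(\<integral>x. partial i (partial j \<phi>) x * \<psi> x \<partial>lborel) = (\<integral>x. partial j (partial i \<phi>) x * \<psi> x \<partial>lborel)"
proof -
  have sm: "smooth \<phi>" "smooth (partial i \<phi>)" using test_funD(1)[OF \<phi>] ij smooth_partial by blast+
  have ci: "continuous_on UNIV \<psi>" "continuous_on UNIV (partial i \<psi>)"
    using \<psi> ij smooth_imp_continuous_on smooth_partial by blast+
  have int: "integrable lborel (\<lambda>x. \<phi> (x + c) * partial i \<psi> x)"
    "integrable lborel (\<lambda>x. partial i \<phi> (x + c) * \<psi> x)" for c
    using integrable_translate[OF test_fun_integrable[OF \<phi>], of "\<lambda>x. partial i \<psi> (x - c)" c]
      integrable_translate[OF test_fun_integrable[OF test_fun_partial[OF \<phi> ij(1)]], of "\<lambda>x. \<psi> (x - c)" c]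
      continuous_on_compose2[OF ci(1), of UNIV "\<lambda>x. x - c"]
      continuous_on_compose2[OF ci(2), of UNIV "\<lambda>x. x - c"]
    by (simp_all add: continuous_on_diff)
  have [measurable]: "\<phi> \<in> borel_measurable borel" "partial i \<phi> \<in> borel_measurable borel"
      "\<psi> \<in> borel_measurable borel" "partial i \<psi> \<in> borel_measurable borel"
    using sm ci by (auto intro!: borel_measurable_continuous_onI smooth_imp_continuous_on)
  have shift: "(\<integral>x. partial i \<phi> (x + c) * \<psi> x \<partial>lborel) = - (\<integral>x. \<phi> (x + c) * partial i \<psi> x \<partial>lborel)" for c
  proof -
    have "(\<integral>x. partial i \<phi> (x + c) * \<psi> x \<partial>lborel) = (\<integral>x. partial i \<phi> x * \<psi> (x + - c) \<partial>lborel)"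
      using integral_translate[of "\<lambda>x. partial i \<phi> x * \<psi> (x + - c)" c] by simp
    also have "\<dots> = - (\<integral>x. \<phi> x * partial i \<psi> (x + - c) \<partial>lborel)"
      by (subst integration_by_parts[OF \<phi> ij(1) smooth_translate[OF \<psi>]])
         (simp only: partial_translate[OF smooth_imp_differentiable[OF \<psi>]])
    also have "(\<integral>x. \<phi> x * partial i \<psi> (x + - c) \<partial>lborel) = (\<integral>x. \<phi> (x + c) * partial i \<psi> x \<partial>lborel)"
      using integral_translate[of "\<lambda>x. \<phi> x * partial i \<psi> (x + - c)" c] by simp
    finally show ?thesis .
  qed
  have eq: "(\<integral>x. real (Suc n) * (partial i \<phi> (x + c) - partial i \<phi> x) * \<psi> x \<partial>lborel)
      = - (\<integral>x. real (Suc n) * (\<phi> (x + c) - \<phi> x) * partial i \<psi> x \<partial>lborel)" for n c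
    using shift[of c] shift[of 0] int[of c] int[of 0]
    by (simp add: mult.assoc left_diff_distrib) (simp add: algebra_simps)
  have "(\<lambda>n. \<integral>x. real (Suc n) * (partial i \<phi> (x + (1 / real (Suc n)) *\<^sub>R j) - partial i \<phi> x) * \<psi> x \<partial>lborel)
     \<longlonglongrightarrow> - (\<integral>x. partial j \<phi> x * partial i \<psi> x \<partial>lborel)"
    unfolding eq
    by (intro tendsto_minus integral_difference_quotient_tendsto[OF \<phi> ij(2) ci(2)])
  with integral_difference_quotient_tendsto[OF test_fun_partial[OF \<phi> ij(1)] ij(2) ci(1)]
  have "(\<integral>x. partial j (partial i \<phi>) x * \<psi> x \<partial>lborel) = - (\<integral>x. partial j \<phi> x * partial i \<psi> x \<partial>lborel)"
    using LIMSEQ_unique by blast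
  also have "\<dots> = (\<integral>x. partial i (partial j \<phi>) x * \<psi> x \<partial>lborel)"
    using integration_by_parts[OF test_fun_partial[OF \<phi> ij(2)] ij(1) \<psi>] by simp
  finally show ?thesis by simp
qed

section \<open>Square-integrable functions\<close>

lemma L2_mult_integrable:
  fixes f g :: "'a \<Rightarrow> real"
  assumes [measurable]: "f \<in> borel_measurable M" "g \<in> borel_measurable M"
    and "integrable M (\<lambda>x. (f x)\<^sup>2)" "integrable M (\<lambda>x. (g x)\<^sup>2)"
  shows "integrable M (\<lambda>x. f x * g x)"
proof (rule Bochner_Integration.integrable_bound)
  show "integrable M (\<lambda>x. (f x)\<^sup>2 + (g x)\<^sup>2)" using assms by auto
  have "\<bar>a * b\<bar> \<le> a\<^sup>2 + b\<^sup>2" for a b :: real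
    using sum_squares_bound[of a b] sum_squares_bound[of a "-b"] by (auto simp: abs_if)
  then show "AE x in M. norm (f x * g x) \<le> norm ((f x)\<^sup>2 + (g x)\<^sup>2)" by auto
qed measurable

lemma L2_Cauchy_Schwarz:
  fixes f g :: "'a \<Rightarrow> real"
  assumes m[measurable]: "f \<in> borel_measurable M" "g \<in> borel_measurable M"
    and i: "integrable M (\<lambda>x. (f x)\<^sup>2)" "integrable M (\<lambda>x. (g x)\<^sup>2)"
  shows "(\<integral>x. \<bar>f x * g x\<bar> \<partial>M) \<le> sqrt (\<integral>x. (f x)\<^sup>2 \<partial>M) * sqrt (\<integral>x. (g x)\<^sup>2 \<partial>M)"
proof -
  let ?P = "\<integral>x. \<bar>f x * g x\<bar> \<partial>M" and ?F = "\<integral>x. (f x)\<^sup>2 \<partial>M" and ?G = "\<integral>x. (g x)\<^sup>2 \<partial>M"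
  have "(\<integral>\<^sup>+x. ennreal \<bar>f x\<bar> * ennreal \<bar>g x\<bar> \<partial>M)\<^sup>2
     \<le> (\<integral>\<^sup>+x. ennreal \<bar>f x\<bar> ^ 2 \<partial>M) * (\<integral>\<^sup>+x. ennreal \<bar>g x\<bar> ^ 2 \<partial>M)"
    by (rule Cauchy_Schwarz_nn_integral) auto
  also have "(\<integral>\<^sup>+x. ennreal \<bar>f x\<bar> * ennreal \<bar>g x\<bar> \<partial>M) = (\<integral>\<^sup>+x. ennreal \<bar>f x * g x\<bar> \<partial>M)"
    by (simp add: ennreal_mult abs_mult)
  also have "\<dots> = ennreal ?P"
    using L2_mult_integrable[OF m i] by (intro nn_integral_eq_integral) auto
  also have "(\<integral>\<^sup>+x. ennreal \<bar>f x\<bar> ^ 2 \<partial>M) = ennreal ?F"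
    using i by (subst nn_integral_eq_integral[symmetric]) (auto simp: ennreal_power)
  also have "(\<integral>\<^sup>+x. ennreal \<bar>g x\<bar> ^ 2 \<partial>M) = ennreal ?G"
    using i by (subst nn_integral_eq_integral[symmetric]) (auto simp: ennreal_power)
  finally have "?P\<^sup>2 \<le> ?F * ?G"
    by (simp add: ennreal_power ennreal_mult[symmetric])
  then have "sqrt (?P\<^sup>2) \<le> sqrt (?F * ?G)" by (rule real_sqrt_le_mono)
  then show ?thesis by (simp add: real_sqrt_mult)
qed

lemma L2_Cauchy_Schwarz_abs:
  fixes f g :: "'a \<Rightarrow> real"
  assumes "f \<in> borel_measurable M" "g \<in> borel_measurable M"
    and "integrable M (\<lambda>x. (f x)\<^sup>2)" "integrable M (\<lambda>x. (g x)\<^sup>2)"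
  shows "\<bar>\<integral>x. f x * g x \<partial>M\<bar> \<le> sqrt (\<integral>x. (f x)\<^sup>2 \<partial>M) * sqrt (\<integral>x. (g x)\<^sup>2 \<partial>M)"
  using L2_Cauchy_Schwarz[OF assms] integral_abs_bound[of M "\<lambda>x. f x * g x"] by linarith

lemma L2_triangle:
  fixes f g :: "'a \<Rightarrow> real"
  assumes m: "f \<in> borel_measurable M" "g \<in> borel_measurable M"
    and i: "integrable M (\<lambda>x. (f x)\<^sup>2)" "integrable M (\<lambda>x. (g x)\<^sup>2)"
  shows "integrable M (\<lambda>x. (f x + g x)\<^sup>2)"
    and "sqrt (\<integral>x. (f x + g x)\<^sup>2 \<partial>M) \<le> sqrt (\<integral>x. (f x)\<^sup>2 \<partial>M) + sqrt (\<integral>x. (g x)\<^sup>2 \<partial>M)"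
proof -
  have eq: "(\<lambda>x. (f x + g x)\<^sup>2) = (\<lambda>x. (f x)\<^sup>2 + (g x)\<^sup>2 + 2 * (f x * g x))"
    by (simp add: power2_sum mult.assoc)
  show "integrable M (\<lambda>x. (f x + g x)\<^sup>2)"
    unfolding eq using i L2_mult_integrable[OF m i] by auto
  have "(\<integral>x. (f x + g x)\<^sup>2 \<partial>M) = (\<integral>x. (f x)\<^sup>2 \<partial>M) + (\<integral>x. (g x)\<^sup>2 \<partial>M) + 2 * (\<integral>x. f x * g x \<partial>M)"
    unfolding eq using i L2_mult_integrable[OF m i] by simp
  also have "\<dots> \<le> (sqrt (\<integral>x. (f x)\<^sup>2 \<partial>M) + sqrt (\<integral>x. (g x)\<^sup>2 \<partial>M))\<^sup>2"
    using L2_Cauchy_Schwarz_abs[OF m i] by (simp add: power2_sum)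
  finally show "sqrt (\<integral>x. (f x + g x)\<^sup>2 \<partial>M) \<le> sqrt (\<integral>x. (f x)\<^sup>2 \<partial>M) + sqrt (\<integral>x. (g x)\<^sup>2 \<partial>M)"
    by (intro real_le_lsqrt) auto
qed

section \<open>Sobolev and interpolation inequalities for test functions\<close>

text \<open>Fundamental theorem of calculus on a ray that leaves the support.\<close>

lemma abs_le_nn_integral_partial:
  fixes \<phi> :: "'a::euclidean_space \<Rightarrow> real"
  assumes \<phi>: "test_fun U \<phi>" and i: "i \<in> Basis"
  shows "ennreal \<bar>\<phi> y\<bar> \<le> (\<integral>\<^sup>+s. ennreal \<bar>partial i \<phi> (y + s *\<^sub>R i)\<bar> \<partial>lborel)"
proof -
  obtain K where K: "compact K" "K \<subseteq> U" "\<And>x. x \<notin> K \<Longrightarrow> \<phi> x = 0"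
    by (rule test_fun_compact_support[OF \<phi>]) (rule that)
  obtain R where R: "\<And>x. x \<in> K \<Longrightarrow> norm x \<le> R"
    using compact_imp_bounded[OF K(1)] by (auto simp: bounded_iff)
  \<comment> \<open>Long enough for \<open>y + S *\<^sub>R i\<close> to lie outside the support.\<close>
  define S where "S = \<bar>R\<bar> + norm y + 1"
  have S: "0 \<le> S" by (simp add: S_def)
  have "S = norm (S *\<^sub>R i)" using i S by simp
  also have "\<dots> \<le> norm (y + S *\<^sub>R i) + norm y"
    using norm_triangle_ineq4[of "y + S *\<^sub>R i" y] by simp
  finally have "\<not> norm (y + S *\<^sub>R i) \<le> R" by (simp add: S_def)
  then have 0: "\<phi> (y + S *\<^sub>R i) = 0" using R K(3) by blast
  let ?g = "\<lambda>s. partial i \<phi> (y + s *\<^sub>R i)"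
  have sm: "smooth \<phi>" "smooth (partial i \<phi>)" using test_funD(1)[OF \<phi>] i smooth_partial by auto
  have c: "continuous_on A ?g" for A
    by (intro continuous_on_compose2[OF smooth_imp_continuous_on[OF sm(2), of UNIV]] continuous_intros) auto
  have "(\<integral>s. indicator {0..S} s *\<^sub>R ?g s \<partial>lborel) = \<phi> (y + S *\<^sub>R i) - \<phi> (y + 0 *\<^sub>R i)"
    by (rule integral_FTC_Icc) (use S c sm smooth_has_derivative_line in auto)
  then have "\<bar>\<phi> y\<bar> = norm (\<integral>s. indicator {0..S} s *\<^sub>R ?g s \<partial>lborel)" using 0 by simp
  also have "ennreal \<dots> \<le> (\<integral>\<^sup>+s. norm (indicator {0..S} s *\<^sub>R ?g s) \<partial>lborel)"
    by (intro integral_norm_bound_ennreal borel_integrable_compact c) auto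
  also have "\<dots> \<le> (\<integral>\<^sup>+s. ennreal \<bar>?g s\<bar> \<partial>lborel)"
    by (intro nn_integral_mono) (auto simp: indicator_def)
  finally show ?thesis .
qed

lemma test_fun_partials:
  "test_fun U \<phi> \<Longrightarrow> set is \<subseteq> Basis \<Longrightarrow> test_fun U (foldr partial is \<phi>)"
  by (induction "is") (auto intro: test_fun_partial)

text \<open>One direction at a time: each further direction contributes one integration along a ray. The
integral is taken over the product measure on coordinate functions, since this is the form in which
directions can be added one by one; once all of \<open>Basis\<close> is used up it becomes the
Lebesgue integral.\<close>

lemma abs_le_nn_integral_partials:
  fixes \<phi> :: "'a::euclidean_space \<Rightarrow> real"
  assumes "test_fun U \<phi>" "distinct is" "set is \<subseteq> Basis"
  shows "ennreal \<bar>\<phi> x\<bar> \<le>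
    (\<integral>\<^sup>+s. ennreal \<bar>foldr partial is \<phi> (x + (\<Sum>j\<in>set is. s j *\<^sub>R j))\<bar> \<partial>(\<Pi>\<^sub>M j\<in>set is. lborel))"
  using assms(2,3)
proof (induction "is")
  case Nil
  interpret product_sigma_finite "\<lambda>_. lborel :: real measure" by standard
  show ?case unfolding list.set by (subst nn_integral_empty) auto
next
  case (Cons i "is")
  interpret product_sigma_finite "\<lambda>_. lborel :: real measure" by standard
  let ?P = "foldr partial is \<phi>" and ?Q = "foldr partial (i # is) \<phi>"
  have P: "test_fun U ?P" and i: "i \<in> Basis" "i \<notin> set is"
    using Cons.prems assms(1) by (auto intro: test_fun_partials)
  have "smooth ?Q" using test_funD(1)[OF test_fun_partials[OF assms(1) Cons.prems(2)]] .
  then have [measurable]: "?Q \<in> borel_measurable borel"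
    by (intro borel_measurable_continuous_onI smooth_imp_continuous_on)
  have "ennreal \<bar>\<phi> x\<bar> \<le> (\<integral>\<^sup>+s. ennreal \<bar>?P (x + (\<Sum>j\<in>set is. s j *\<^sub>R j))\<bar> \<partial>(\<Pi>\<^sub>M j\<in>set is. lborel))"
    using Cons by simp
  also have "\<dots> \<le> (\<integral>\<^sup>+s. \<integral>\<^sup>+t. ennreal \<bar>?Q (x + (\<Sum>j\<in>set is. s j *\<^sub>R j) + t *\<^sub>R i)\<bar> \<partial>lborel \<partial>(\<Pi>\<^sub>M j\<in>set is. lborel))"
    using abs_le_nn_integral_partial[OF P i(1)] by (intro nn_integral_mono) simp
  also have "\<dots> = (\<integral>\<^sup>+s. \<integral>\<^sup>+t. ennreal \<bar>?Q (x + (\<Sum>j\<in>set (i # is). (s(i := t)) j *\<^sub>R j))\<bar> \<partial>lborel \<partial>(\<Pi>\<^sub>M j\<in>set is. lborel))"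
  proof -
    have "(\<Sum>j\<in>set is. (s(i := t)) j *\<^sub>R j) = (\<Sum>j\<in>set is. s j *\<^sub>R j)" for s and t :: real
      using i(2) by (intro sum.cong) auto
    then have "(\<Sum>j\<in>set (i # is). (s(i := t)) j *\<^sub>R j) = t *\<^sub>R i + (\<Sum>j\<in>set is. s j *\<^sub>R j)" for s and t :: real
      using i(2) by simp
    then show ?thesis by (simp only: add.assoc add.commute[of "_ *\<^sub>R i"])
  qed
  also have "\<dots> = (\<integral>\<^sup>+s. ennreal \<bar>?Q (x + (\<Sum>j\<in>set (i # is). s j *\<^sub>R j))\<bar> \<partial>(\<Pi>\<^sub>M j\<in>set (i # is). lborel))"
    unfolding list.set
    by (rule product_nn_integral_insert[symmetric]) (use i in \<open>simp_all only: finite_set, measurable\<close>)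
  finally show ?case .
qed

text \<open>The elementary Sobolev embedding $W^{n,1}(\mathbb R^n)\subset L^\infty(\mathbb R^n)$: differentiating
once in every coordinate direction is enough to control point values by an $L^1$ norm.\<close>

lemma abs_le_integral_mixed_partial:
  fixes \<phi> :: "'a::euclidean_space \<Rightarrow> real"
  assumes \<phi>: "test_fun U \<phi>" and "is": "distinct is" "set is = Basis"
  shows "\<bar>\<phi> x\<bar> \<le> (\<integral>y. \<bar>foldr partial is \<phi> y\<bar> \<partial>lborel)"
proof -
  let ?Q = "foldr partial is \<phi>"
  have Q: "test_fun U ?Q" using \<phi> "is" by (intro test_fun_partials) auto
  have [measurable]: "?Q \<in> borel_measurable borel"
    using test_funD(1)[OF Q] by (intro borel_measurable_continuous_onI smooth_imp_continuous_on)
  have int: "integrable lborel ?Q" using test_fun_integrable[OF Q, of "\<lambda>_. 1"] by simp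
  have "ennreal \<bar>\<phi> x\<bar> \<le> (\<integral>\<^sup>+s. ennreal \<bar>?Q (x + (\<Sum>j\<in>Basis. s j *\<^sub>R j))\<bar> \<partial>(\<Pi>\<^sub>M j\<in>Basis. lborel))"
    using abs_le_nn_integral_partials[OF \<phi> "is"(1), of x] by (simp add: "is"(2))
  also have "\<dots> = (\<integral>\<^sup>+y. ennreal \<bar>?Q (x + y)\<bar> \<partial>lborel)"
    unfolding lborel_eq[where 'a='a] by (subst nn_integral_distr) auto
  also have "\<dots> = (\<integral>\<^sup>+y. ennreal \<bar>?Q y\<bar> \<partial>distr lborel borel ((+) x))"
    by (subst nn_integral_distr) auto
  also have "\<dots> = (\<integral>\<^sup>+y. ennreal \<bar>?Q y\<bar> \<partial>lborel)" by (simp add: lborel_distr_plus)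
  also have "\<dots> = ennreal (\<integral>y. \<bar>?Q y\<bar> \<partial>lborel)"
    using int by (intro nn_integral_eq_integral) auto
  finally show ?thesis by (simp add: ennreal_le_iff)
qed

lemma test_fun_L2:
  fixes \<phi> :: "'a::euclidean_space \<Rightarrow> real"
  assumes "test_fun U \<phi>"
  shows "\<phi> \<in> borel_measurable lborel" "integrable lborel (\<lambda>x. (\<phi> x)\<^sup>2)"
  using test_fun_integrable[OF assms, of \<phi>] smooth_imp_continuous_on[OF test_funD(1)[OF assms]]
  by (auto intro: borel_measurable_continuous_onI simp: power2_eq_square)

definition laplacian :: "('a::euclidean_space \<Rightarrow> real) \<Rightarrow> 'a \<Rightarrow> real" where
  "laplacian \<phi> x = (\<Sum>i\<in>Basis. partial i (partial i \<phi>) x)"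

lemma test_fun_laplacian:
  fixes \<phi> :: "'a::euclidean_space \<Rightarrow> real"
  assumes \<phi>: "test_fun U \<phi>"
  shows "test_fun U (laplacian \<phi>)"
proof (rule test_fun_support_subset[OF \<phi>])
  have "smooth (partial i (partial i \<phi>))" if "i \<in> Basis" for i
    using test_funD(1)[OF \<phi>] that by (intro smooth_partial)
  then show "smooth (laplacian \<phi>)"
    unfolding smooth_def laplacian_def[abs_def] by (auto intro: Ck_sum)
  have \<phi>': "test_fun (closure {x. \<phi> x \<noteq> 0}) \<phi>" using \<phi> by (simp add: test_fun_def)
  have "laplacian \<phi> x = 0" if "x \<notin> closure {x. \<phi> x \<noteq> 0}" for x
    unfolding laplacian_def
    by (intro sum.neutral ballI test_funD(2)[OF _ that] test_fun_partial \<phi>')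
  then show "{x. laplacian \<phi> x \<noteq> 0} \<subseteq> closure {x. \<phi> x \<noteq> 0}" by blast
qed

text \<open>Sum over \<open>i\<close> of the integration by parts
$\int(\partial_i\phi)^2=-\int\phi\,\partial_{ii}\phi$.\<close>

lemma integral_gradient_square:
  fixes \<phi> :: "'a::euclidean_space \<Rightarrow> real"
  assumes \<phi>: "test_fun U \<phi>"
  shows "(\<Sum>i\<in>Basis. \<integral>x. (partial i \<phi> x)\<^sup>2 \<partial>lborel) = - (\<integral>x. \<phi> x * laplacian \<phi> x \<partial>lborel)"
proof -
  have "(\<integral>x. (partial i \<phi> x)\<^sup>2 \<partial>lborel) = - (\<integral>x. \<phi> x * partial i (partial i \<phi>) x \<partial>lborel)"
    if "i \<in> Basis" for i
    using integration_by_parts[OF \<phi> that test_funD(1)[OF test_fun_partial[OF \<phi> that]]]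
    by (simp add: power2_eq_square)
  moreover have "integrable lborel (\<lambda>x. \<phi> x * partial i (partial i \<phi>) x)" if "i \<in> Basis" for i
    using \<phi> that by (intro test_fun_integrable smooth_imp_continuous_on smooth_partial test_funD(1)[OF \<phi>])
  ultimately show ?thesis
    by (simp add: laplacian_def sum_distrib_left sum_negf)
qed

text \<open>Two integrations by parts move one derivative of each factor to the other one; the mixed derivatives
met on the way are reordered by \<open>weak_partial_commute\<close>. This is what makes the
full Hessian in $L^2$ controlled by the Laplacian alone.\<close>

lemma integral_mixed_partial_square:
  fixes \<phi> :: "'a::euclidean_space \<Rightarrow> real"
  assumes \<phi>: "test_fun U \<phi>" and ij: "i \<in> Basis" "j \<in> Basis"
  shows "(\<integral>x. (partial j (partial i \<phi>) x)\<^sup>2 \<partial>lborel)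
    = (\<integral>x. partial i (partial i \<phi>) x * partial j (partial j \<phi>) x \<partial>lborel)"
proof -
  have T: "test_fun U (partial i \<phi>)" "test_fun U (partial j \<phi>)" "test_fun U (partial j (partial i \<phi>))"
      "test_fun U (partial i (partial i \<phi>))"
    using \<phi> ij by (auto intro: test_fun_partial)
  note S = T[THEN test_funD(1)]
  have "(\<integral>x. (partial j (partial i \<phi>) x)\<^sup>2 \<partial>lborel)
      = (\<integral>x. partial i (partial j \<phi>) x * partial j (partial i \<phi>) x \<partial>lborel)"
    using weak_partial_commute[OF \<phi> ij S(3)] by (simp add: power2_eq_square)
  also have "\<dots> = - (\<integral>x. partial j \<phi> x * partial i (partial j (partial i \<phi>)) x \<partial>lborel)"
    by (rule integration_by_parts[OF T(2) ij(1) S(3)])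
  also have "(\<integral>x. partial j \<phi> x * partial i (partial j (partial i \<phi>)) x \<partial>lborel)
      = (\<integral>x. partial j \<phi> x * partial j (partial i (partial i \<phi>)) x \<partial>lborel)"
    using weak_partial_commute[OF T(1) ij S(2)] by (simp add: mult.commute)
  also have "\<dots> = - (\<integral>x. partial j (partial j \<phi>) x * partial i (partial i \<phi>) x \<partial>lborel)"
    using integration_by_parts[OF T(2) ij(2) S(4)] by simp
  finally show ?thesis by (simp add: mult.commute)
qed

lemma gradient_L2_le:
  fixes \<phi> :: "'a::euclidean_space \<Rightarrow> real"
  assumes \<phi>: "test_fun U \<phi>"
  shows "(\<Sum>i\<in>Basis. \<integral>x. (partial i \<phi> x)\<^sup>2 \<partial>lborel)
    \<le> sqrt (\<integral>x. (\<phi> x)\<^sup>2 \<partial>lborel) * sqrt (\<integral>x. (laplacian \<phi> x)\<^sup>2 \<partial>lborel)"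
  using L2_Cauchy_Schwarz_abs[OF test_fun_L2(1)[OF \<phi>] test_fun_L2(1)[OF test_fun_laplacian[OF \<phi>]]
      test_fun_L2(2)[OF \<phi>] test_fun_L2(2)[OF test_fun_laplacian[OF \<phi>]]]
  unfolding integral_gradient_square[OF \<phi>] by linarith

text \<open>The Sobolev bound is applied to $\phi^2$, which is quadratic and so leads to $L^2$ norms.
In dimension one $\partial(\phi^2)=2\phi\,\partial\phi$ gives
$\phi^4\le 4a^2\|\partial\phi\|^2\le 4a^3b$. In dimension two
$\partial_j\partial_i(\phi^2)=2\partial_j\phi\,\partial_i\phi+2\phi\,\partial_j\partial_i\phi$ gives
$\phi^2\le\|\nabla\phi\|^2+2a\|\partial_j\partial_i\phi\|\le 3ab$, hence $\phi^4\le 9a^2b^2$. The right-hand side of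
the statement dominates both, and what matters for its use is that it tends to zero with
\<open>a\<close> for bounded \<open>b\<close>.\<close>

theorem sup_le_L2_laplacian:
  fixes \<phi> :: "'a::euclidean_space \<Rightarrow> real"
  assumes \<phi>: "test_fun U \<phi>" and dim: "DIM('a) \<le> 2"
  defines "a \<equiv> sqrt (\<integral>x. (\<phi> x)\<^sup>2 \<partial>lborel)" and "b \<equiv> sqrt (\<integral>x. (laplacian \<phi> x)\<^sup>2 \<partial>lborel)"
  shows "(\<phi> x) ^ 4 \<le> 9 * a\<^sup>2 * b * (a + b)"
proof -
  have a: "0 \<le> a" and b: "0 \<le> b" by (simp_all add: a_def b_def)
  have sm: "smooth \<phi>" by (rule test_funD(1)[OF \<phi>])
  let ?F = "\<lambda>x. \<phi> x * \<phi> x"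
  have F: "test_fun U ?F" by (rule test_fun_mult[OF \<phi> sm])
  have dF: "partial i ?F = (\<lambda>x. 2 * (\<phi> x * partial i \<phi> x))" for i
    by (simp add: fun_eq_iff partial_mult smooth_imp_differentiable[OF sm])
  have "DIM('a) = 1 \<or> DIM('a) = 2" using dim DIM_positive[where 'a='a] by linarith
  then show ?thesis
  proof
    assume "DIM('a) = 1"
    then obtain i :: 'a where B: "Basis = {i}" by (auto simp: card_1_singleton_iff)
    then have i: "i \<in> Basis" by blast
    define g where "g = sqrt (\<integral>x. (partial i \<phi> x)\<^sup>2 \<partial>lborel)"
    have "g\<^sup>2 \<le> a * b"
      using gradient_L2_le[OF \<phi>] by (simp add: B g_def a_def b_def)
    have "\<bar>?F x\<bar> \<le> (\<integral>y. \<bar>2 * (\<phi> y * partial i \<phi> y)\<bar> \<partial>lborel)"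
      using abs_le_integral_mixed_partial[OF F, of "[i]" x] by (simp add: B dF)
    also have "\<dots> = 2 * (\<integral>y. \<bar>\<phi> y * partial i \<phi> y\<bar> \<partial>lborel)" by (simp add: abs_mult)
    also have "\<dots> \<le> 2 * (a * g)"
      using L2_Cauchy_Schwarz[OF test_fun_L2(1)[OF \<phi>] test_fun_L2(1)[OF test_fun_partial[OF \<phi> i]]
          test_fun_L2(2)[OF \<phi>] test_fun_L2(2)[OF test_fun_partial[OF \<phi> i]]]
      by (simp add: a_def g_def)
    finally have "(\<phi> x)\<^sup>2 \<le> 2 * (a * g)" by (simp add: power2_eq_square)
    then have "((\<phi> x)\<^sup>2)\<^sup>2 \<le> (2 * (a * g))\<^sup>2" by (intro power_mono) auto
    also have "\<dots> = 4 * a\<^sup>2 * g\<^sup>2" by (simp add: power_mult_distrib)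
    also have "\<dots> \<le> 4 * a\<^sup>2 * (a * b)" using \<open>g\<^sup>2 \<le> a * b\<close> by (intro mult_left_mono) auto
    also have "\<dots> \<le> 4 * a\<^sup>2 * (a * b) + (5 * a\<^sup>2 * (a * b) + 9 * a\<^sup>2 * (b * b))" using a b by simp
    also have "\<dots> = 9 * a\<^sup>2 * b * (a + b)" by (simp add: algebra_simps)
    finally show ?thesis by simp
  next
    assume "DIM('a) = 2"
    then obtain i j :: 'a where B: "Basis = {i, j}" and ne: "i \<noteq> j" by (auto simp: card_2_iff)
    then have i: "i \<in> Basis" and j: "j \<in> Basis" by blast+
    note T = test_fun_partial[OF \<phi> i] test_fun_partial[OF \<phi> j]
    note T2 = test_fun_partial[OF T(1) i] test_fun_partial[OF T(2) j] test_fun_partial[OF T(1) j]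
    define p where "p = sqrt (\<integral>x. (partial j (partial i \<phi>) x)\<^sup>2 \<partial>lborel)"
    have "p\<^sup>2 = (\<integral>x. (partial j (partial i \<phi>) x)\<^sup>2 \<partial>lborel)" by (simp add: p_def)
    have ij: "integrable lborel (\<lambda>x. partial i (partial i \<phi>) x * partial j (partial j \<phi>) x)"
      using L2_mult_integrable T2[THEN test_fun_L2(1)] T2[THEN test_fun_L2(2)] by blast
    have lap: "(laplacian \<phi> x)\<^sup>2 = (partial i (partial i \<phi>) x)\<^sup>2 + (partial j (partial j \<phi>) x)\<^sup>2
        + 2 * (partial i (partial i \<phi>) x * partial j (partial j \<phi>) x)" for x
      using ne by (simp add: laplacian_def B power2_sum mult.assoc)
    have "b\<^sup>2 = (\<integral>x. (laplacian \<phi> x)\<^sup>2 \<partial>lborel)" by (simp add: b_def)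
    also have "\<dots> = (\<integral>x. (partial i (partial i \<phi>) x)\<^sup>2 \<partial>lborel)
        + (\<integral>x. (partial j (partial j \<phi>) x)\<^sup>2 \<partial>lborel) + 2 * p\<^sup>2"
      unfolding lap \<open>p\<^sup>2 = _\<close> integral_mixed_partial_square[OF \<phi> i j]
      using T2[THEN test_fun_L2(2)] ij by simp
    finally have "p\<^sup>2 \<le> b\<^sup>2"
      using Bochner_Integration.integral_nonneg[of lborel "\<lambda>x. (partial i (partial i \<phi>) x)\<^sup>2"]
        Bochner_Integration.integral_nonneg[of lborel "\<lambda>x. (partial j (partial j \<phi>) x)\<^sup>2"]
        zero_le_power2[of p] by auto
    then have "p \<le> b" using b by (rule power2_le_imp_le)
    have sp: "smooth (partial i \<phi>)" using sm i by (rule smooth_partial)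
    have ddF: "partial j (partial i ?F) y
        = 2 * (partial j \<phi> y * partial i \<phi> y) + 2 * (\<phi> y * partial j (partial i \<phi>) y)" for y
    proof -
      have "partial i ?F = (\<lambda>x. (2 * \<phi> x) * partial i \<phi> x)" by (simp add: dF mult.assoc)
      moreover have "partial j (\<lambda>x. 2 * \<phi> x) y = 2 * partial j \<phi> y"
        using partial_mult[of "\<lambda>_. 2" y \<phi> j] smooth_imp_differentiable[OF sm, of y]
        by (simp add: partial_def)
      ultimately show ?thesis
        using smooth_imp_differentiable[OF sm] smooth_imp_differentiable[OF sp]
        by (simp add: partial_mult)
    qed
    have "\<bar>?F x\<bar> \<le> (\<integral>y. \<bar>partial j (partial i ?F) y\<bar> \<partial>lborel)"
      using abs_le_integral_mixed_partial[OF F, of "[j, i]" x] ne by (simp add: B insert_commute)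
    also have "\<dots> \<le> (\<integral>y. (partial i \<phi> y)\<^sup>2 + (partial j \<phi> y)\<^sup>2 + 2 * \<bar>\<phi> y * partial j (partial i \<phi>) y\<bar> \<partial>lborel)"
    proof (rule integral_mono)
      show "integrable lborel (\<lambda>y. \<bar>partial j (partial i ?F) y\<bar>)"
        using test_fun_integrable[OF test_fun_partial[OF test_fun_partial[OF F i] j], of "\<lambda>_. 1"] by simp
      show "integrable lborel (\<lambda>y. (partial i \<phi> y)\<^sup>2 + (partial j \<phi> y)\<^sup>2 + 2 * \<bar>\<phi> y * partial j (partial i \<phi>) y\<bar>)"
        using T[THEN test_fun_L2(2)]
          test_fun_integrable[OF \<phi> smooth_imp_continuous_on[OF test_funD(1)[OF T2(3)]]] by auto
      have "\<bar>2 * (u * v) + 2 * w\<bar> \<le> v\<^sup>2 + u\<^sup>2 + 2 * \<bar>w\<bar>" for u v w :: real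
        using sum_squares_bound[of u v] sum_squares_bound[of u "-v"] by (auto simp: abs_if)
      then show "\<bar>partial j (partial i ?F) y\<bar>
          \<le> (partial i \<phi> y)\<^sup>2 + (partial j \<phi> y)\<^sup>2 + 2 * \<bar>\<phi> y * partial j (partial i \<phi>) y\<bar>" for y
        by (simp only: ddF)
    qed
    also have "\<dots> = (\<Sum>i\<in>Basis. \<integral>x. (partial i \<phi> x)\<^sup>2 \<partial>lborel)
        + 2 * (\<integral>y. \<bar>\<phi> y * partial j (partial i \<phi>) y\<bar> \<partial>lborel)"
      using T[THEN test_fun_L2(2)] ne
        test_fun_integrable[OF \<phi> smooth_imp_continuous_on[OF test_funD(1)[OF T2(3)]]]
      by (simp add: B)
    also have "\<dots> \<le> a * b + 2 * (a * p)"
      using gradient_L2_le[OF \<phi>] L2_Cauchy_Schwarz[OF test_fun_L2(1)[OF \<phi>] test_fun_L2(1)[OF T2(3)]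
          test_fun_L2(2)[OF \<phi>] test_fun_L2(2)[OF T2(3)]]
      by (simp add: a_def b_def p_def)
    also have "\<dots> \<le> 3 * (a * b)" using mult_left_mono[OF \<open>p \<le> b\<close> a] by simp
    finally have "(\<phi> x)\<^sup>2 \<le> 3 * (a * b)" by (simp add: power2_eq_square)
    then have "((\<phi> x)\<^sup>2)\<^sup>2 \<le> (3 * (a * b))\<^sup>2" by (intro power_mono) auto
    also have "\<dots> = 9 * a\<^sup>2 * b * b" by (simp add: power2_eq_square)
    also have "\<dots> \<le> 9 * a\<^sup>2 * b * (a + b)" using a b by (intro mult_left_mono) auto
    finally show ?thesis by simp
  qed
qed

section \<open>Bump functions and the fundamental lemma of the calculus of variations\<close>

text \<open>The family is closed under differentiation (\<open>flat_DERIV\<close>), so that smoothness of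
$e^{-1/t}$, extended by zero, reduces to continuity of its members. The argument of the polynomial
is $1/t$.\<close>

definition flat :: "real poly \<Rightarrow> real \<Rightarrow> real" where
  "flat p t = (if t > 0 then poly p (1 / t) * exp (- (1 / t)) else 0)"

lemma poly_times_exp_tendsto_0: "((\<lambda>y. poly p y * exp (- y)) \<longlongrightarrow> 0) at_top" for p :: "real poly"
proof -
  have "((\<lambda>y. \<Sum>i\<le>degree p. coeff p i * (y ^ i / exp y)) \<longlongrightarrow> (\<Sum>i\<le>degree p. coeff p i * 0)) at_top"
    by (intro tendsto_intros tendsto_power_div_exp_0)
  then show ?thesis
    by (simp add: poly_altdef exp_minus sum_distrib_right divide_inverse mult.assoc)
qed

lemma flat_tendsto_0: "(flat p \<longlongrightarrow> 0) (at 0)"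
proof (rule filterlim_split_at)
  show "(flat p \<longlongrightarrow> 0) (at_left 0)"
    by (rule tendsto_eventually) (auto simp: eventually_at_filter flat_def)
  have "((\<lambda>t. poly p (inverse t) * exp (- inverse t)) \<longlongrightarrow> 0) (at_right 0)"
    by (rule filterlim_compose[OF poly_times_exp_tendsto_0 filterlim_inverse_at_top_right])
  then show "(flat p \<longlongrightarrow> 0) (at_right 0)"
    by (rule Lim_transform_eventually)
       (auto simp: eventually_at_filter flat_def inverse_eq_divide)
qed

text \<open>At the origin the difference quotient \<open>flat p h / h\<close> is again a member of the family, namely
that of the polynomial $X p$, and it tends to zero like all of them.\<close>

lemma flat_DERIV: "DERIV (flat p) t :> flat (pCons 0 (pCons 0 (p - pderiv p))) t"
proof -
  consider "t > 0" | "t < 0" | "t = 0" by linarith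
  then show ?thesis
  proof cases
    case 1
    have "DERIV (\<lambda>t. poly p (1 / t) * exp (- (1 / t))) t :> flat (pCons 0 (pCons 0 (p - pderiv p))) t"
      using 1 by (auto intro!: derivative_eq_intros DERIV_chain2[OF poly_DERIV]
          simp: flat_def field_simps power2_eq_square)
    then show ?thesis
      by (rule has_field_derivative_transform_within_open[of _ _ _ "{0<..}"]) (use 1 in \<open>auto simp: flat_def\<close>)
  next
    case 2
    have "DERIV (\<lambda>t. 0) t :> flat (pCons 0 (pCons 0 (p - pderiv p))) t"
      using 2 by (simp add: flat_def)
    then show ?thesis
      by (rule has_field_derivative_transform_within_open[of _ _ _ "{..<0}"]) (use 2 in \<open>auto simp: flat_def\<close>)
  next
    case 3
    have "((\<lambda>h. flat p h / h) \<longlongrightarrow> 0) (at 0)"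
      by (rule Lim_transform_eventually[OF flat_tendsto_0[of "pCons 0 p"]])
         (auto simp: eventually_at_filter flat_def)
    with 3 show ?thesis by (simp add: DERIV_def flat_def)
  qed
qed

lemma Ck_flat: "Ck k (\<lambda>x. flat p (s * (x \<bullet> i) + d))"
proof (induction k arbitrary: p)
  case 0
  have "isCont (flat p) t" for p t using flat_DERIV DERIV_isCont by blast
  then have "continuous_on UNIV (flat p)" for p by (simp add: continuous_at_imp_continuous_on)
  then have "continuous_on UNIV (\<lambda>x. flat p (s * (x \<bullet> i) + d))"
    by (rule continuous_on_compose2) (auto intro!: continuous_intros)
  then show ?case by simp
next
  case (Suc k)
  let ?q = "pCons 0 (pCons 0 (p - pderiv p))"
  have D: "((\<lambda>x. flat p (s * (x \<bullet> i) + d)) has_derivative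
      (\<lambda>h. (s * (h \<bullet> i)) * flat ?q (s * (x \<bullet> i) + d))) (at x)" for x
    by (rule DERIV_compose_FDERIV[OF flat_DERIV]) (auto intro!: derivative_eq_intros)
  then have "partial j (\<lambda>x. flat p (s * (x \<bullet> i) + d)) = (\<lambda>x. (s * (j \<bullet> i)) * flat ?q (s * (x \<bullet> i) + d))" for j
    using partial_eqI by blast
  with D Suc show ?case by (auto simp: differentiable_def intro!: Ck_mult Ck_const)
qed

text \<open>Smooth approximation of the indicator of a box from below. Since \<open>flat 1 (n * s)\<close> tends to
1 for each positive \<open>s\<close> and is 0 for the other ones, scaling the distances to the faces turns
the product into the indicator in the limit. Each factor has the form in which \<open>Ck_flat\<close> applies.\<close>

definition box_bump :: "nat \<Rightarrow> 'a::euclidean_space \<Rightarrow> 'a \<Rightarrow> 'a \<Rightarrow> real" where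
  "box_bump n a b x = (\<Prod>i\<in>Basis. flat 1 (real (Suc n) * (x \<bullet> i) + - (real (Suc n) * (a \<bullet> i))) *
     flat 1 (- real (Suc n) * (x \<bullet> i) + real (Suc n) * (b \<bullet> i)))"

lemma flat_1_bounds: "0 \<le> flat 1 t" "flat 1 t \<le> 1"
  by (auto simp: flat_def)

lemma box_bump_bounds: "0 \<le> box_bump n a b x" "box_bump n a b x \<le> 1"
  unfolding box_bump_def by (auto intro!: prod_nonneg prod_le_1 mult_le_one flat_1_bounds mult_nonneg_nonneg)

lemma box_bump_outside: "x \<notin> box a b \<Longrightarrow> box_bump n a b x = 0"
proof -
  assume "x \<notin> box a b"
  then obtain i where i: "i \<in> Basis" "x \<bullet> i \<le> a \<bullet> i \<or> b \<bullet> i \<le> x \<bullet> i" by (force simp: mem_box)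
  have "flat 1 (real (Suc n) * (x \<bullet> i) + - (real (Suc n) * (a \<bullet> i))) *
     flat 1 (- real (Suc n) * (x \<bullet> i) + real (Suc n) * (b \<bullet> i)) = 0"
  proof (cases "x \<bullet> i \<le> a \<bullet> i")
    case True
    then have "real (Suc n) * (x \<bullet> i) \<le> real (Suc n) * (a \<bullet> i)" by (intro mult_left_mono) auto
    then show ?thesis by (simp add: flat_def del: of_nat_Suc)
  next
    case False
    with i have "real (Suc n) * (b \<bullet> i) \<le> real (Suc n) * (x \<bullet> i)" by (intro mult_left_mono) auto
    then show ?thesis by (simp add: flat_def del: of_nat_Suc)
  qed
  with i(1) show ?thesis unfolding box_bump_def by (intro prod_zero) auto
qed

lemma flat_1_scaled_tendsto:
  assumes "c > 0"
  shows "(\<lambda>n. flat 1 (real (Suc n) * c)) \<longlonglongrightarrow> 1"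
proof -
  have "(\<lambda>n. exp (- (1 / real (Suc n)) * (1 / c))) \<longlonglongrightarrow> exp (- 0 * (1 / c))"
    by (intro tendsto_intros LIMSEQ_Suc[OF lim_1_over_n])
  then show ?thesis using assms by (simp add: flat_def)
qed

lemma box_bump_tendsto: "(\<lambda>n. box_bump n a b x) \<longlonglongrightarrow> indicator (box a b) x"
proof (cases "x \<in> box a b")
  case True
  have "(\<lambda>n. box_bump n a b x) \<longlonglongrightarrow> (\<Prod>i\<in>(Basis :: 'a set). 1 * 1)"
    unfolding box_bump_def
  proof (intro tendsto_prod tendsto_mult)
    fix i :: 'a assume "i \<in> Basis"
    with True have "x \<bullet> i - a \<bullet> i > 0" "b \<bullet> i - x \<bullet> i > 0" by (auto simp: mem_box)
    from this[THEN flat_1_scaled_tendsto]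
    show "(\<lambda>n. flat 1 (real (Suc n) * (x \<bullet> i) + - (real (Suc n) * (a \<bullet> i)))) \<longlonglongrightarrow> 1"
      "(\<lambda>n. flat 1 (- real (Suc n) * (x \<bullet> i) + real (Suc n) * (b \<bullet> i))) \<longlonglongrightarrow> 1"
      by (simp_all add: algebra_simps)
  qed
  with True show ?thesis by simp
next
  case False
  then show ?thesis by (simp add: box_bump_outside)
qed

lemma test_fun_box_bump:
  assumes "cbox a b \<subseteq> U"
  shows "test_fun U (box_bump n a b)"
proof -
  have "{x. box_bump n a b x \<noteq> 0} \<subseteq> cbox a b"
    using box_bump_outside box_subset_cbox by blast
  then have "closure {x. box_bump n a b x \<noteq> 0} \<subseteq> cbox a b"
    by (intro closure_minimal closed_cbox)
  moreover from this have "compact (closure {x. box_bump n a b x \<noteq> 0})"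
    by (meson bounded_cbox bounded_subset closed_closure compact_eq_bounded_closed)
  moreover have "smooth (box_bump n a b)"
    unfolding smooth_def box_bump_def[abs_def] by (intro allI Ck_prod Ck_mult Ck_flat)
  ultimately show ?thesis using assms unfolding test_fun_def by (meson order_trans)
qed

text \<open>Testing with the bump functions of a closed box shows that the integral over every box inside
\<open>U\<close> vanishes, and almost every value of an integrable function is the limit of its averages over
shrinking cubes. The boxes are countably many, so the exceptional sets add up to a null set.\<close>

theorem fundamental_lemma_calculus_of_variations:
  fixes g :: "'a::euclidean_space \<Rightarrow> 'b::euclidean_space"
  assumes U: "open U" and g: "loc_integrable U g"
    and 0: "\<And>\<phi>::'a \<Rightarrow> real. test_fun U \<phi> \<Longrightarrow> (LINT x:U|lebesgue. \<phi> x *\<^sub>R g x) = 0"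
  shows "AE x in lebesgue. x \<in> U \<longrightarrow> g x = 0"
proof -
  have box0: "integral (cbox a b) g = 0" if sub: "cbox a b \<subseteq> U" for a b
  proof -
    have int: "set_integrable lebesgue (cbox a b) g" using g sub by (simp add: loc_integrable_def)
    then have mg: "(\<lambda>x. indicator (cbox a b) x *\<^sub>R g x) \<in> borel_measurable lebesgue"
      unfolding set_integrable_def by auto
    have mb: "box_bump n a b \<in> borel_measurable lebesgue" for n
      using smooth_imp_continuous_on[OF test_funD(1)[OF test_fun_box_bump[OF sub]]]
      by (intro measurable_completion) (simp add: borel_measurable_continuous_onI)
    have "(\<lambda>n. \<integral>x. box_bump n a b x *\<^sub>R (indicator (cbox a b) x *\<^sub>R g x) \<partial>lebesgue)
        \<longlonglongrightarrow> (\<integral>x. indicator (box a b) x *\<^sub>R (indicator (cbox a b) x *\<^sub>R g x) \<partial>lebesgue)"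
    proof (rule integral_dominated_convergence)
      show "integrable lebesgue (\<lambda>x. norm (indicator (cbox a b) x *\<^sub>R g x))"
        using int unfolding set_integrable_def by (rule integrable_norm)
      show "AE x in lebesgue. norm (box_bump n a b x *\<^sub>R (indicator (cbox a b) x *\<^sub>R g x))
          \<le> norm (indicator (cbox a b) x *\<^sub>R g x)" for n
        using box_bump_bounds[of n a b] by (intro AE_I2) (simp add: mult.assoc mult_left_le_one_le)
      show "AE x in lebesgue. (\<lambda>n. box_bump n a b x *\<^sub>R (indicator (cbox a b) x *\<^sub>R g x))
          \<longlonglongrightarrow> indicator (box a b) x *\<^sub>R (indicator (cbox a b) x *\<^sub>R g x)"
        by (intro AE_I2 tendsto_intros box_bump_tendsto)
      show "(\<lambda>x. indicator (box a b) x *\<^sub>R (indicator (cbox a b) x *\<^sub>R g x)) \<in> borel_measurable lebesgue"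
        by (intro borel_measurable_scaleR borel_measurable_indicator mg) auto
      show "(\<lambda>x. box_bump n a b x *\<^sub>R (indicator (cbox a b) x *\<^sub>R g x)) \<in> borel_measurable lebesgue" for n
        by (intro borel_measurable_scaleR mg mb)
    qed
    moreover have "(\<integral>x. box_bump n a b x *\<^sub>R (indicator (cbox a b) x *\<^sub>R g x) \<partial>lebesgue) = 0" for n
    proof -
      have "(\<integral>x. box_bump n a b x *\<^sub>R (indicator (cbox a b) x *\<^sub>R g x) \<partial>lebesgue)
          = (LINT x:U|lebesgue. box_bump n a b x *\<^sub>R g x)"
        unfolding set_lebesgue_integral_def
      proof (intro Bochner_Integration.integral_cong refl)
        fix x
        have "x \<notin> cbox a b \<Longrightarrow> box_bump n a b x = 0"
          using box_subset_cbox[of a b] by (intro box_bump_outside) blast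
        then show "box_bump n a b x *\<^sub>R (indicator (cbox a b) x *\<^sub>R g x)
            = indicator U x *\<^sub>R (box_bump n a b x *\<^sub>R g x)"
          using sub by (cases "x \<in> cbox a b") auto
      qed
      with 0[OF test_fun_box_bump[OF sub]] show ?thesis by simp
    qed
    ultimately have "(\<integral>x. indicator (box a b) x *\<^sub>R (indicator (cbox a b) x *\<^sub>R g x) \<partial>lebesgue) = 0"
      by (simp add: LIMSEQ_const_iff)
    also have "(\<integral>x. indicator (box a b) x *\<^sub>R (indicator (cbox a b) x *\<^sub>R g x) \<partial>lebesgue)
        = (LINT x:box a b|lebesgue. g x)"
      unfolding set_lebesgue_integral_def using box_subset_cbox[of a b]
      by (intro Bochner_Integration.integral_cong) (auto simp: indicator_def)
    also have "\<dots> = integral (box a b) g"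
      using set_integrable_subset[OF int _ box_subset_cbox]
      by (intro set_lebesgue_integral_eq_integral) auto
    finally show ?thesis by (simp add: integral_open_interval)
  qed
  have ae: "AE x in lebesgue. x \<in> cbox c d \<longrightarrow> g x = 0" if sub: "cbox c d \<subseteq> U" for c d
  proof -
    \<comment> \<open>The differentiation theorem asks for integrability on all boxes, while \<open>g\<close> is
      controlled only inside \<open>U\<close>.\<close>
    define f where "f x = (if x \<in> cbox c d then g x else 0)" for x
    have "g absolutely_integrable_on cbox c d" using g sub by (simp add: loc_integrable_def)
    then have "f absolutely_integrable_on UNIV"
      unfolding f_def[abs_def] by (simp only: absolutely_integrable_restrict_UNIV)
    then have "f integrable_on cbox a b" for a b
      using set_lebesgue_integral_eq_integral(1) integrable_on_subcbox by blast
    then obtain N where N: "negligible N"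
       "\<And>x e. \<lbrakk>x \<notin> N; 0 < e\<rbrakk> \<Longrightarrow> \<exists>\<delta>>0. \<forall>h. 0 < h \<and> h < \<delta> \<longrightarrow>
                norm(integral (cbox x (x + h *\<^sub>R One)) f /\<^sub>R h ^ DIM('a) - f x) < e"
      using integrable_ccontinuous_explicit by blast
    have "g x = 0" if x: "x \<in> box c d" "x \<notin> N" for x
    proof (rule ccontr)
      assume "g x \<noteq> 0"
      then have "f x \<noteq> 0" using x box_subset_cbox[of c d] by (auto simp: f_def)
      then obtain \<delta> where \<delta>: "\<delta> > 0" "\<And>h. 0 < h \<Longrightarrow> h < \<delta> \<Longrightarrow>
          norm (integral (cbox x (x + h *\<^sub>R One)) f /\<^sub>R h ^ DIM('a) - f x) < norm (f x)"
        using N(2)[OF x(2), of "norm (f x)"] by auto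
      \<comment> \<open>Cubes of edge \<open>h \<le> m\<close> with lower corner \<open>x\<close> stay inside the box.\<close>
      define m where "m = Min ((\<lambda>i. d \<bullet> i - x \<bullet> i) ` Basis)"
      have "m > 0" unfolding m_def using x(1) by (subst Min_gr_iff) (auto simp: mem_box)
      have m: "m \<le> d \<bullet> i - x \<bullet> i" if "i \<in> Basis" for i unfolding m_def using that by (intro Min_le) auto
      define h where "h = min m \<delta> / 2"
      have h: "0 < h" "h < \<delta>" "h \<le> m" using \<open>m > 0\<close> \<delta>(1) by (auto simp: h_def min_def)
      have "cbox x (x + h *\<^sub>R One) \<subseteq> cbox c d"
      proof
        fix y assume y: "y \<in> cbox x (x + h *\<^sub>R One)"
        show "y \<in> cbox c d"
          unfolding mem_box
        proof
          fix i :: 'a assume i: "i \<in> Basis"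
          then have "x \<bullet> i \<le> y \<bullet> i" "y \<bullet> i \<le> x \<bullet> i + h" using y by (auto simp: mem_box inner_add_left)
          moreover have "c \<bullet> i < x \<bullet> i" using x i by (auto simp: mem_box)
          ultimately show "c \<bullet> i \<le> y \<bullet> i \<and> y \<bullet> i \<le> d \<bullet> i" using h(3) m[OF i] by linarith
        qed
      qed
      then have "integral (cbox x (x + h *\<^sub>R One)) f = integral (cbox x (x + h *\<^sub>R One)) g"
        by (intro integral_cong) (auto simp: f_def)
      also have "\<dots> = 0" using box0 \<open>cbox x _ \<subseteq> cbox c d\<close> sub by blast
      finally show False using \<delta>(2)[OF h(1,2)] by simp
    qed
    then have "{x. \<not> (x \<in> cbox c d \<longrightarrow> g x = 0)} \<subseteq> N \<union> (cbox c d - box c d)" by blast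
    moreover have "negligible (N \<union> (cbox c d - box c d))"
      by (rule negligible_Un[OF N(1) negligible_frontier_interval])
    ultimately have "{x. \<not> (x \<in> cbox c d \<longrightarrow> g x = 0)} \<in> null_sets lebesgue"
      using negligible_subset negligible_iff_null_sets by blast
    then show ?thesis by (simp add: eventually_ae_filter) (metis (no_types, lifting) subset_refl)
  qed
  obtain D where D: "countable D" "D \<subseteq> Pow U" "\<And>X. X \<in> D \<Longrightarrow> \<exists>a b. X = cbox a b" "\<Union>D = U"
    using open_countable_Union_open_cbox[OF U] by metis
  have "AE x in lebesgue. \<forall>X\<in>D. x \<in> X \<longrightarrow> g x = 0"
  proof (subst AE_ball_countable[OF D(1)], intro ballI)
    fix X assume X: "X \<in> D"
    then obtain a b where "X = cbox a b" using D(3) by blast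
    then show "AE x in lebesgue. x \<in> X \<longrightarrow> g x = 0" using ae[of a b] D(2) X by blast
  qed
  then show ?thesis by eventually_elim (use D(4) in blast)
qed

section \<open>Weak derivatives\<close>

lemma test_fun_times_loc_integrable:
  fixes \<phi> :: "'a::euclidean_space \<Rightarrow> real" and g :: "'a \<Rightarrow> 'b::euclidean_space"
  assumes \<phi>: "test_fun U \<phi>" and g: "loc_integrable U g"
  shows "set_integrable lebesgue U (\<lambda>x. \<phi> x *\<^sub>R g x)"
proof -
  obtain K where K: "compact K" "K \<subseteq> U" "\<And>x. x \<notin> K \<Longrightarrow> \<phi> x = 0"
    by (rule test_fun_compact_support[OF \<phi>]) (rule that)
  obtain B where B: "\<And>x. \<bar>\<phi> x\<bar> \<le> B" using test_fun_bounded[OF \<phi>] by blast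
  have int: "integrable lebesgue (\<lambda>x. indicator K x *\<^sub>R g x)"
    using g K by (simp add: loc_integrable_def set_integrable_def)
  then have mg: "(\<lambda>x. indicator K x *\<^sub>R g x) \<in> borel_measurable lebesgue" by auto
  have m\<phi>: "\<phi> \<in> borel_measurable lebesgue"
    using smooth_imp_continuous_on[OF test_funD(1)[OF \<phi>]]
    by (intro measurable_completion) (simp add: borel_measurable_continuous_onI)
  have "integrable lebesgue (\<lambda>x. \<phi> x *\<^sub>R (indicator K x *\<^sub>R g x))"
  proof (rule Bochner_Integration.integrable_bound)
    show "integrable lebesgue (\<lambda>x. B *\<^sub>R norm (indicator K x *\<^sub>R g x))"
      using int by (intro integrable_scaleR_right integrable_norm)
    show "(\<lambda>x. \<phi> x *\<^sub>R (indicator K x *\<^sub>R g x)) \<in> borel_measurable lebesgue"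
      by (intro borel_measurable_scaleR mg m\<phi>)
    show "AE x in lebesgue. norm (\<phi> x *\<^sub>R (indicator K x *\<^sub>R g x)) \<le> norm (B *\<^sub>R norm (indicator K x *\<^sub>R g x))"
    proof (rule AE_I2)
      fix x
      have "norm (\<phi> x *\<^sub>R y) \<le> norm (B *\<^sub>R norm y)" for y :: 'b
        using B[of x] by (auto simp: abs_mult intro!: mult_right_mono)
      then show "norm (\<phi> x *\<^sub>R (indicator K x *\<^sub>R g x)) \<le> norm (B *\<^sub>R norm (indicator K x *\<^sub>R g x))" .
    qed
  qed
  moreover have "\<phi> x *\<^sub>R (indicator K x *\<^sub>R g x) = indicator U x *\<^sub>R (\<phi> x *\<^sub>R g x)" for x
    using K(2) K(3)[of x] by (cases "x \<in> K") (auto simp: indicator_def)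
  ultimately show ?thesis by (simp only: set_integrable_def)
qed

lemma loc_integrable_diff: "loc_integrable U f \<Longrightarrow> loc_integrable U g \<Longrightarrow> loc_integrable U (\<lambda>x. f x - g x)"
  by (simp add: loc_integrable_def)

lemma loc_integrable_continuous:
  fixes f :: "'a::euclidean_space \<Rightarrow> real"
  assumes "continuous_on UNIV f"
  shows "loc_integrable U f"
  unfolding loc_integrable_def
proof (intro allI impI)
  fix K assume "compact K \<and> K \<subseteq> U"
  then have "integrable lborel (\<lambda>x. indicator K x *\<^sub>R f x)"
    using assms by (intro borel_integrable_compact continuous_on_subset[OF assms]) auto
  then show "set_integrable lebesgue K f"
    unfolding set_integrable_def by (subst integrable_completion) auto
qed

text \<open>Uniqueness turns the arbitrary representative selected by \<open>weak_partial\<close> into a well-defined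
element of $L^p$; every identity below between iterated weak derivatives rests on it.\<close>

lemma has_weak_partial_unique:
  fixes f :: "'a::euclidean_space \<Rightarrow> 'b::euclidean_space"
  assumes U: "open U" and g: "has_weak_partial U i f g" and h: "has_weak_partial U i f h"
  shows "AE x in lebesgue. x \<in> U \<longrightarrow> g x = h x"
proof -
  have loc: "loc_integrable U g" "loc_integrable U h" using g h by (auto simp: has_weak_partial_def)
  have "(LINT x:U|lebesgue. \<phi> x *\<^sub>R (g x - h x)) = 0" if \<phi>: "test_fun U \<phi>" for \<phi> :: "'a \<Rightarrow> real"
  proof -
    have "(LINT x:U|lebesgue. \<phi> x *\<^sub>R g x) = (LINT x:U|lebesgue. \<phi> x *\<^sub>R h x)"
      using g h \<phi> unfolding has_weak_partial_def by (metis neg_equal_iff_equal)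
    then show ?thesis
      using \<phi> loc[THEN test_fun_times_loc_integrable[OF \<phi>]] by (simp add: scaleR_diff_right)
  qed
  from fundamental_lemma_calculus_of_variations[OF U loc_integrable_diff[OF loc] this]
  show ?thesis by simp
qed

lemma has_weak_partial_diff:
  fixes f f' :: "'a::euclidean_space \<Rightarrow> 'b::euclidean_space"
  assumes i: "i \<in> Basis" and f: "has_weak_partial U i f g" and f': "has_weak_partial U i f' g'"
  shows "has_weak_partial U i (\<lambda>x. f x - f' x) (\<lambda>x. g x - g' x)"
proof -
  have loc: "loc_integrable U f" "loc_integrable U f'" "loc_integrable U g" "loc_integrable U g'"
    using f f' by (auto simp: has_weak_partial_def)
  show ?thesis
    unfolding has_weak_partial_def
  proof (intro conjI allI impI loc_integrable_diff loc)
    fix \<phi> :: "'a \<Rightarrow> real" assume \<phi>: "test_fun U \<phi>"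
    have "(LINT x:U|lebesgue. partial i \<phi> x *\<^sub>R f x) = - (LINT x:U|lebesgue. \<phi> x *\<^sub>R g x)"
      "(LINT x:U|lebesgue. partial i \<phi> x *\<^sub>R f' x) = - (LINT x:U|lebesgue. \<phi> x *\<^sub>R g' x)"
      using f f' \<phi> by (auto simp: has_weak_partial_def)
    then show "(LINT x:U|lebesgue. partial i \<phi> x *\<^sub>R (f x - f' x)) = - (LINT x:U|lebesgue. \<phi> x *\<^sub>R (g x - g' x))"
      using loc(1,2)[THEN test_fun_times_loc_integrable[OF test_fun_partial[OF \<phi> i]]]
        loc(3,4)[THEN test_fun_times_loc_integrable[OF \<phi>]]
      by (simp add: scaleR_diff_right)
  qed
qed

lemma has_weak_partial_cong_AE:
  fixes f f' :: "'a::euclidean_space \<Rightarrow> 'b::euclidean_space"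
  assumes i: "i \<in> Basis" and U: "open U" and f: "has_weak_partial U i f g"
    and f': "loc_integrable U f'" and ae: "AE x in lebesgue. x \<in> U \<longrightarrow> f x = f' x"
  shows "has_weak_partial U i f' g"
proof -
  have "(LINT x:U|lebesgue. partial i \<phi> x *\<^sub>R f x) = (LINT x:U|lebesgue. partial i \<phi> x *\<^sub>R f' x)"
    if \<phi>: "test_fun U \<phi>" for \<phi> :: "'a \<Rightarrow> real"
  proof -
    have "loc_integrable U f" using f by (simp add: has_weak_partial_def)
    from test_fun_times_loc_integrable[OF test_fun_partial[OF \<phi> i] this]
      test_fun_times_loc_integrable[OF test_fun_partial[OF \<phi> i] f']
    show ?thesis
      unfolding set_integrable_def set_lebesgue_integral_def
      using ae by (intro integral_cong_AE) (auto elim!: eventually_mono simp: indicator_def)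
  qed
  with f f' show ?thesis by (simp add: has_weak_partial_def)
qed

lemma set_integral_eq_lborel:
  fixes h :: "'a::euclidean_space \<Rightarrow> real"
  assumes "continuous_on UNIV h" "\<And>x. x \<notin> U \<Longrightarrow> h x = 0"
  shows "(LINT x:U|lebesgue. h x) = (\<integral>x. h x \<partial>lborel)"
proof -
  have "(LINT x:U|lebesgue. h x) = (\<integral>x. h x \<partial>lebesgue)"
    unfolding set_lebesgue_integral_def
    by (intro Bochner_Integration.integral_cong) (use assms(2) in \<open>auto simp: indicator_def\<close>)
  also have "\<dots> = (\<integral>x. h x \<partial>lborel)"
    using assms(1) by (intro integral_completion) (simp add: borel_measurable_continuous_onI)
  finally show ?thesis .
qed

lemma has_weak_partial_smooth:
  fixes \<phi> :: "'a::euclidean_space \<Rightarrow> real"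
  assumes i: "i \<in> Basis" and \<phi>: "smooth \<phi>"
  shows "has_weak_partial U i \<phi> (partial i \<phi>)"
proof -
  have c: "continuous_on UNIV \<phi>" "continuous_on UNIV (partial i \<phi>)"
    using i \<phi> by (auto intro: smooth_imp_continuous_on smooth_partial)
  have "(LINT x:U|lebesgue. partial i \<theta> x *\<^sub>R \<phi> x) = - (LINT x:U|lebesgue. \<theta> x *\<^sub>R partial i \<phi> x)"
    if \<theta>: "test_fun U \<theta>" for \<theta> :: "'a \<Rightarrow> real"
  proof -
    have c': "continuous_on UNIV \<theta>" "continuous_on UNIV (partial i \<theta>)"
      using i test_funD(1)[OF \<theta>] by (auto intro: smooth_imp_continuous_on smooth_partial)
    have "(LINT x:U|lebesgue. partial i \<theta> x *\<^sub>R \<phi> x) = (\<integral>x. partial i \<theta> x * \<phi> x \<partial>lborel)"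
      using c c' test_funD(2)[OF test_fun_partial[OF \<theta> i]]
      by (subst set_integral_eq_lborel) (auto intro!: continuous_intros)
    also have "\<dots> = - (\<integral>x. \<theta> x * partial i \<phi> x \<partial>lborel)"
      by (rule integration_by_parts[OF \<theta> i \<phi>])
    also have "(\<integral>x. \<theta> x * partial i \<phi> x \<partial>lborel) = (LINT x:U|lebesgue. \<theta> x *\<^sub>R partial i \<phi> x)"
      using c c' test_funD(2)[OF \<theta>]
      by (subst set_integral_eq_lborel) (auto intro!: continuous_intros)
    finally show ?thesis .
  qed
  with c show ?thesis by (simp add: has_weak_partial_def loc_integrable_continuous)
qed

lemma weak_partialI: "has_weak_partial U i f g \<Longrightarrow> has_weak_partial U i f (weak_partial U i f)"
  unfolding weak_partial_def by (rule someI[of "has_weak_partial U i f"])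

section \<open>The space $L^2$ on a set\<close>

lemma norm_powr_2: "norm (y::real) powr 2 = y\<^sup>2"
  by (cases "y = 0") (auto simp: powr_numeral)

text \<open>Multiplying by the indicator reduces $L^2(S)$ to square-integrable functions on the whole space, where
the triangle inequality is available.\<close>

lemma Lp_2_iff:
  fixes f :: "'a::euclidean_space \<Rightarrow> real"
  shows "f \<in> Lp 2 S \<longleftrightarrow> (\<lambda>x. indicator S x * f x) \<in> borel_measurable lebesgue \<and>
     integrable lebesgue (\<lambda>x. (indicator S x * f x)\<^sup>2)"
proof -
  have "(\<lambda>x. indicat_real S x *\<^sub>R (f x)\<^sup>2) = (\<lambda>x. (indicator S x * f x)\<^sup>2)"
    by (auto simp: fun_eq_iff indicator_def)
  then show ?thesis
    by (simp add: Lp_def set_borel_measurable_def set_integrable_def norm_powr_2 del: real_norm_def)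
qed

lemma Lp_norm_2:
  fixes f :: "'a::euclidean_space \<Rightarrow> real"
  shows "Lp_norm 2 S f = sqrt (\<integral>x. (indicator S x * f x)\<^sup>2 \<partial>lebesgue)"
proof -
  have "(\<lambda>x. indicat_real S x *\<^sub>R (f x)\<^sup>2) = (\<lambda>x. (indicator S x * f x)\<^sup>2)"
    by (auto simp: fun_eq_iff indicator_def)
  moreover have "0 \<le> (\<integral>x. (indicator S x * f x)\<^sup>2 \<partial>lebesgue)" by simp
  ultimately show ?thesis
    by (simp add: Lp_norm_def set_lebesgue_integral_def norm_powr_2 powr_half_sqrt del: real_norm_def)
qed

lemma Lp_norm_nonneg: "0 \<le> Lp_norm p S f"
  by (simp add: Lp_norm_def)

lemma Lp_2_add:
  fixes f g :: "'a::euclidean_space \<Rightarrow> real"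
  assumes "f \<in> Lp 2 S" "g \<in> Lp 2 S"
  shows "(\<lambda>x. f x + g x) \<in> Lp 2 S"
    and "Lp_norm 2 S (\<lambda>x. f x + g x) \<le> Lp_norm 2 S f + Lp_norm 2 S g"
  using assms L2_triangle[of "\<lambda>x. indicator S x * f x" lebesgue "\<lambda>x. indicator S x * g x"]
    borel_measurable_add[of "\<lambda>x. indicator S x * f x" lebesgue "\<lambda>x. indicator S x * g x"]
  unfolding Lp_2_iff Lp_norm_2 by (simp_all add: distrib_left)

lemma Lp_2_cmult:
  fixes f :: "'a::euclidean_space \<Rightarrow> real"
  assumes "f \<in> Lp 2 S"
  shows "(\<lambda>x. c * f x) \<in> Lp 2 S" and "Lp_norm 2 S (\<lambda>x. c * f x) = \<bar>c\<bar> * Lp_norm 2 S f"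
proof -
  have eq: "indicator S x * (c * f x) = c * (indicator S x * f x)" for x by simp
  show "(\<lambda>x. c * f x) \<in> Lp 2 S"
    using assms unfolding Lp_2_iff eq by (auto simp: power_mult_distrib)
  show "Lp_norm 2 S (\<lambda>x. c * f x) = \<bar>c\<bar> * Lp_norm 2 S f"
    unfolding Lp_norm_2 eq by (simp add: power_mult_distrib[of c] real_sqrt_mult)
qed

lemma Lp_2_diff:
  fixes f g :: "'a::euclidean_space \<Rightarrow> real"
  assumes "f \<in> Lp 2 S" "g \<in> Lp 2 S"
  shows "(\<lambda>x. f x - g x) \<in> Lp 2 S"
    and "Lp_norm 2 S (\<lambda>x. f x - g x) \<le> Lp_norm 2 S f + Lp_norm 2 S g"
  using Lp_2_add[OF assms(1) Lp_2_cmult(1)[OF assms(2), of "-1"]] Lp_2_cmult(2)[OF assms(2), of "-1"]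
  by simp_all

lemma Lp_2_sum:
  fixes f :: "'i \<Rightarrow> 'a::euclidean_space \<Rightarrow> real"
  assumes "\<And>i. i \<in> I \<Longrightarrow> f i \<in> Lp 2 S"
  shows "(\<lambda>x. \<Sum>i\<in>I. f i x) \<in> Lp 2 S \<and> Lp_norm 2 S (\<lambda>x. \<Sum>i\<in>I. f i x) \<le> (\<Sum>i\<in>I. Lp_norm 2 S (f i))"
  using assms
proof (induction I rule: infinite_finite_induct)
  case (insert i I)
  then show ?case
    using Lp_2_add[of "f i" S "\<lambda>x. \<Sum>i\<in>I. f i x"] by fastforce
qed (simp_all add: Lp_2_iff Lp_norm_2)

lemma Lp_norm_2_cong_AE:
  fixes f g :: "'a::euclidean_space \<Rightarrow> real"
  assumes "f \<in> Lp 2 S" "AE x in lebesgue. x \<in> S \<longrightarrow> f x = g x"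
  shows "Lp_norm 2 S g = Lp_norm 2 S f"
proof -
  have m: "(\<lambda>x. indicator S x * f x) \<in> borel_measurable lebesgue"
    using assms(1) by (simp add: Lp_2_iff)
  have ae: "AE x in lebesgue. indicator S x * f x = indicator S x * g x"
    using assms(2) by (auto elim!: eventually_mono simp: indicator_def)
  have m': "(\<lambda>x. indicator S x * g x) \<in> borel_measurable lebesgue"
    using m ae by (rule borel_measurable_AE)
  show "Lp_norm 2 S g = Lp_norm 2 S f"
    unfolding Lp_norm_2 using m m' ae
    by (intro arg_cong[of _ _ sqrt] integral_cong_AE) (auto elim!: eventually_mono)
qed

lemma test_fun_Lp_2:
  fixes \<phi> :: "'a::euclidean_space \<Rightarrow> real"
  assumes \<phi>: "test_fun U \<phi>"
  shows "\<phi> \<in> Lp 2 U" "Lp_norm 2 U \<phi> = sqrt (\<integral>x. (\<phi> x)\<^sup>2 \<partial>lborel)"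
proof -
  have eq: "(\<lambda>x. indicator U x * \<phi> x) = \<phi>"
    using test_funD(2)[OF \<phi>] by (auto simp: fun_eq_iff indicator_def)
  have m: "\<phi> \<in> borel_measurable lborel" and i: "integrable lborel (\<lambda>x. (\<phi> x)\<^sup>2)"
    using test_fun_L2[OF \<phi>] by auto
  then have m2: "(\<lambda>x. (\<phi> x)\<^sup>2) \<in> borel_measurable lborel" by auto
  show "\<phi> \<in> Lp 2 U"
    unfolding Lp_2_iff eq[THEN fun_cong] using m i m2
    by (simp add: integrable_completion measurable_completion)
  show "Lp_norm 2 U \<phi> = sqrt (\<integral>x. (\<phi> x)\<^sup>2 \<partial>lborel)"
    unfolding Lp_norm_2 eq[THEN fun_cong] using m2 by (simp add: integral_completion)
qed

section \<open>Point values of functions in $W^{2,2}_0$\<close>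

lemma Wkp_SucD:
  assumes "f \<in> Wkp (Suc k) p U"
  shows "f \<in> Lp p U" "i \<in> Basis \<Longrightarrow> has_weak_partial U i f (weak_partial U i f)"
    "i \<in> Basis \<Longrightarrow> weak_partial U i f \<in> Wkp k p U"
proof -
  show "f \<in> Lp p U" "i \<in> Basis \<Longrightarrow> weak_partial U i f \<in> Wkp k p U"
    using assms by simp_all
  show "has_weak_partial U i f (weak_partial U i f)" if i: "i \<in> Basis"
  proof -
    obtain g where "has_weak_partial U i f g" using assms i by auto
    then show ?thesis by (rule weak_partialI)
  qed
qed

lemma Wkp_norm_nonneg: "0 \<le> Wkp_norm k p U f"
  by (induction k arbitrary: f) (auto intro!: add_nonneg_nonneg sum_nonneg Lp_norm_nonneg)

lemma Wkp_2_2_weak_laplacian: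
  fixes f :: "'a::euclidean_space \<Rightarrow> real"
  assumes "f \<in> Wkp 2 2 U"
  shows "weak_laplacian U f \<in> Lp 2 U"
proof -
  have "weak_partial U i (weak_partial U i f) \<in> Lp 2 U" if "i \<in> Basis" for i
    using assms that by (simp add: numeral_2_eq_2)
  then have "(\<lambda>x. \<Sum>i\<in>Basis. weak_partial U i (weak_partial U i f) x) \<in> Lp 2 U"
    using Lp_2_sum[of Basis "\<lambda>i. weak_partial U i (weak_partial U i f)" U] by blast
  then show ?thesis by (simp add: weak_laplacian_def[abs_def])
qed

lemma weak_partial_diff_smooth:
  fixes f :: "'a::euclidean_space \<Rightarrow> real"
  assumes U: "open U" and i: "i \<in> Basis" and f: "has_weak_partial U i f g" and \<phi>: "smooth \<phi>"
  shows "has_weak_partial U i (\<lambda>x. f x - \<phi> x) (weak_partial U i (\<lambda>x. f x - \<phi> x))"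
    and "AE x in lebesgue. x \<in> U \<longrightarrow> g x - partial i \<phi> x = weak_partial U i (\<lambda>x. f x - \<phi> x) x"
proof -
  have h: "has_weak_partial U i (\<lambda>x. f x - \<phi> x) (\<lambda>x. g x - partial i \<phi> x)"
    by (rule has_weak_partial_diff[OF i f has_weak_partial_smooth[OF i \<phi>]])
  then show h': "has_weak_partial U i (\<lambda>x. f x - \<phi> x) (weak_partial U i (\<lambda>x. f x - \<phi> x))"
    by (rule weak_partialI)
  show "AE x in lebesgue. x \<in> U \<longrightarrow> g x - partial i \<phi> x = weak_partial U i (\<lambda>x. f x - \<phi> x) x"
    by (rule has_weak_partial_unique[OF U h h'])
qed

text \<open>The Sobolev norm of \<open>f - \<phi>\<close> is formed with selected representatives of its iterated weak
derivatives; up to null sets they are the differences of those of \<open>f\<close> and of the classical ones of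
\<open>\<phi>\<close>.\<close>

lemma second_weak_partial_diff_test_fun:
  fixes f :: "'a::euclidean_space \<Rightarrow> real"
  assumes U: "open U" and i: "i \<in> Basis" and f: "f \<in> Wkp 2 2 U" and \<phi>: "test_fun U \<phi>"
  shows "AE x in lebesgue. x \<in> U \<longrightarrow> weak_partial U i (weak_partial U i f) x - partial i (partial i \<phi>) x
     = weak_partial U i (weak_partial U i (\<lambda>x. f x - \<phi> x)) x"
proof -
  have f2: "f \<in> Wkp (Suc (Suc 0)) 2 U" using f by (simp only: numeral_2_eq_2)
  note w1 = Wkp_SucD(2)[OF f2 i] and w2 = Wkp_SucD(2)[OF Wkp_SucD(3)[OF f2 i] i]
  note h1 = weak_partial_diff_smooth[OF U i w1 test_funD(1)[OF \<phi>]]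
  have "has_weak_partial U i (\<lambda>x. weak_partial U i f x - partial i \<phi> x)
      (\<lambda>x. weak_partial U i (weak_partial U i f) x - partial i (partial i \<phi>) x)"
    by (intro has_weak_partial_diff i w2 has_weak_partial_smooth smooth_partial test_funD(1)[OF \<phi>])
  from has_weak_partial_cong_AE[OF i U this _ h1(2)]
  have h2: "has_weak_partial U i (weak_partial U i (\<lambda>x. f x - \<phi> x))
      (\<lambda>x. weak_partial U i (weak_partial U i f) x - partial i (partial i \<phi>) x)"
    using h1(1) by (simp add: has_weak_partial_def)
  show ?thesis by (rule has_weak_partial_unique[OF U h2 weak_partialI[OF h2]])
qed

lemma weak_laplacian_diff_test_fun_le:
  fixes f :: "'a::euclidean_space \<Rightarrow> real"
  assumes U: "open U" and f: "f \<in> Wkp 2 2 U" and \<phi>: "test_fun U \<phi>"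
  shows "Lp_norm 2 U (\<lambda>x. weak_laplacian U f x - laplacian \<phi> x) \<le> Wkp_norm 2 2 U (\<lambda>x. f x - \<phi> x)"
proof -
  let ?h = "\<lambda>x. f x - \<phi> x"
  let ?d = "\<lambda>i x. weak_partial U i (weak_partial U i f) x - partial i (partial i \<phi>) x"
  have d: "?d i \<in> Lp 2 U" if i: "i \<in> Basis" for i
    using f i test_fun_Lp_2(1)[OF test_fun_partial[OF test_fun_partial[OF \<phi> i] i]]
    by (intro Lp_2_diff) (simp_all add: numeral_2_eq_2)
  have "Lp_norm 2 U (\<lambda>x. weak_laplacian U f x - laplacian \<phi> x) = Lp_norm 2 U (\<lambda>x. \<Sum>i\<in>Basis. ?d i x)"
    by (simp add: weak_laplacian_def laplacian_def sum_subtractf)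
  also have "\<dots> \<le> (\<Sum>i\<in>Basis. Lp_norm 2 U (?d i))"
    using Lp_2_sum[of Basis ?d U] d by blast
  also have "\<dots> = (\<Sum>i\<in>Basis. Lp_norm 2 U (weak_partial U i (weak_partial U i ?h)))"
    using Lp_norm_2_cong_AE[OF d second_weak_partial_diff_test_fun[OF U _ f \<phi>]]
    by (intro sum.cong) auto
  also have "\<dots> \<le> (\<Sum>i\<in>Basis. Lp_norm 2 U (weak_partial U i ?h) +
      (\<Sum>j\<in>Basis. Lp_norm 2 U (weak_partial U j (weak_partial U i ?h))))"
  proof (rule sum_mono)
    fix i :: 'a assume "i \<in> Basis"
    then have "Lp_norm 2 U (weak_partial U i (weak_partial U i ?h))
        \<le> (\<Sum>j\<in>Basis. Lp_norm 2 U (weak_partial U j (weak_partial U i ?h)))"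
      by (intro member_le_sum[where f="\<lambda>j. Lp_norm 2 U (weak_partial U j (weak_partial U i ?h))"])
         (auto simp: Lp_norm_nonneg)
    then show "Lp_norm 2 U (weak_partial U i (weak_partial U i ?h)) \<le> Lp_norm 2 U (weak_partial U i ?h) +
      (\<Sum>j\<in>Basis. Lp_norm 2 U (weak_partial U j (weak_partial U i ?h)))"
      using Lp_norm_nonneg[of 2 U "weak_partial U i ?h"] by linarith
  qed
  also have "\<dots> \<le> Wkp_norm 2 2 U ?h"
    using Lp_norm_nonneg[of 2 U ?h] by (simp add: numeral_2_eq_2)
  finally show ?thesis .
qed

text \<open>Chebyshev's inequality; it excludes that $L^2$-close functions differ by \<open>d\<close> on a ball.\<close>

lemma measure_le_Lp_norm_2:
  fixes f :: "'a::euclidean_space \<Rightarrow> real"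
  assumes f: "f \<in> Lp 2 S" and B: "B \<in> sets lebesgue" "emeasure lebesgue B < \<infinity>" "B \<subseteq> S"
    and ge: "\<And>x. x \<in> B \<Longrightarrow> d \<le> \<bar>f x\<bar>" and d: "0 \<le> d"
  shows "d * sqrt (measure lebesgue B) \<le> Lp_norm 2 S f"
proof -
  have "d\<^sup>2 * measure lebesgue B = (\<integral>x. d\<^sup>2 * indicator B x \<partial>lebesgue)"
    using B by simp
  also have "\<dots> \<le> (\<integral>x. (indicator S x * f x)\<^sup>2 \<partial>lebesgue)"
  proof (rule integral_mono)
    show "integrable lebesgue (\<lambda>x. d\<^sup>2 * indicat_real B x)"
      using B by (intro integrable_mult_right integrable_real_indicator) auto
    show "integrable lebesgue (\<lambda>x. (indicator S x * f x)\<^sup>2)" using f by (simp add: Lp_2_iff)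
    show "d\<^sup>2 * indicat_real B x \<le> (indicator S x * f x)\<^sup>2" for x
    proof (cases "x \<in> B")
      case True
      then have "d\<^sup>2 \<le> \<bar>f x\<bar>\<^sup>2" using ge d by (intro power_mono) auto
      with True B(3) show ?thesis by (auto simp: indicator_def)
    qed simp
  qed
  finally have "sqrt (d\<^sup>2 * measure lebesgue B) \<le> Lp_norm 2 S f"
    unfolding Lp_norm_2 by (rule real_sqrt_le_mono)
  then show ?thesis using d by (simp add: real_sqrt_mult)
qed

text \<open>The bound \<open>sup_le_L2_laplacian\<close> passes to the limit along test functions that converge to
\<open>f\<close> in $W^{2,2}$. An $L^2$ distance says nothing about a single point, but by continuity
a violation at one point persists on a ball with a definite gap, which contradicts $L^2$ convergence.

This is where vanishing boundary values enter: test functions live on the whole space, so the constant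
does not depend on \<open>U\<close>.\<close>

theorem Wkp0_sup_le_L2_weak_laplacian:
  fixes f :: "'a::euclidean_space \<Rightarrow> real"
  assumes dim: "DIM('a) \<le> 2" and U: "open U" and f: "f \<in> Wkp0 2 2 U" and cont: "continuous_on U f"
    and x: "x \<in> U"
  defines "a \<equiv> Lp_norm 2 U f" and "b \<equiv> Lp_norm 2 U (weak_laplacian U f)"
  shows "(f x) ^ 4 \<le> 9 * a\<^sup>2 * b * (a + b)"
proof (rule ccontr)
  assume "\<not> ?thesis"
  then have less: "9 * a\<^sup>2 * b * (a + b) < \<bar>f x\<bar> ^ 4" by simp
  have ab: "0 \<le> a" "0 \<le> b" by (simp_all add: a_def b_def Lp_norm_nonneg)
  have fW: "f \<in> Wkp 2 2 U" using f by (simp add: Wkp0_def)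
  then have fL: "f \<in> Lp 2 U" by (simp add: numeral_2_eq_2)
  obtain \<phi> where \<phi>: "\<And>n::nat. test_fun U (\<phi> n)"
    and conv: "(\<lambda>n. Wkp_norm 2 2 U (\<lambda>x. f x - \<phi> n x)) \<longlonglongrightarrow> 0"
    using f by (auto simp: Wkp0_def)
  define e where "e n = Wkp_norm 2 2 U (\<lambda>x. f x - \<phi> n x)" for n
  have e: "e \<longlonglongrightarrow> 0" using conv by (simp add: e_def[abs_def])
  have e0: "0 \<le> e n" for n by (simp add: e_def Wkp_norm_nonneg)
  have fe: "Lp_norm 2 U (\<lambda>x. f x - \<phi> n x) \<le> e n" for n
    by (simp add: e_def numeral_2_eq_2 sum_nonneg Lp_norm_nonneg)
  have \<phi>a: "Lp_norm 2 U (\<phi> n) \<le> a + e n" for n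
    using Lp_2_diff[OF fL Lp_2_diff(1)[OF fL test_fun_Lp_2(1)[OF \<phi>]], of n] fe[of n]
    by (simp add: a_def)
  have \<phi>b: "Lp_norm 2 U (laplacian (\<phi> n)) \<le> b + e n" for n
    using Lp_2_diff[OF Wkp_2_2_weak_laplacian[OF fW]
        Lp_2_diff(1)[OF Wkp_2_2_weak_laplacian[OF fW] test_fun_Lp_2(1)[OF test_fun_laplacian[OF \<phi>]]], of n]
      weak_laplacian_diff_test_fun_le[OF U fW \<phi>, of n]
    by (simp add: b_def e_def)
  have \<phi>sup: "(\<phi> n y) ^ 4 \<le> 9 * (a + e n)\<^sup>2 * (b + e n) * ((a + e n) + (b + e n))" for n y
  proof -
    let ?a = "Lp_norm 2 U (\<phi> n)" and ?b = "Lp_norm 2 U (laplacian (\<phi> n))"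
    have "(\<phi> n y) ^ 4 \<le> 9 * ?a\<^sup>2 * ?b * (?a + ?b)"
      using sup_le_L2_laplacian[OF \<phi> dim]
      by (simp add: test_fun_Lp_2(2)[OF \<phi>] test_fun_Lp_2(2)[OF test_fun_laplacian[OF \<phi>]])
    also have "\<dots> \<le> 9 * (a + e n)\<^sup>2 * (b + e n) * ((a + e n) + (b + e n))"
      using ab e0 by (intro mult_mono power_mono \<phi>a \<phi>b add_mono order_refl mult_nonneg_nonneg
          add_nonneg_nonneg Lp_norm_nonneg) auto
    finally show ?thesis .
  qed
  have lim: "(\<lambda>n. 9 * (a + e n)\<^sup>2 * (b + e n) * ((a + e n) + (b + e n)))
      \<longlonglongrightarrow> 9 * (a + 0)\<^sup>2 * (b + 0) * ((a + 0) + (b + 0))"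
    by (intro tendsto_intros e)
  \<comment> \<open>A level strictly between the claimed bound and the value at \<open>x\<close>: the approximations
    eventually stay below \<open>m\<close>, while \<open>f\<close> exceeds \<open>m + d\<close> near \<open>x\<close>.\<close>
  define m where "m = root 4 ((9 * a\<^sup>2 * b * (a + b) + \<bar>f x\<bar> ^ 4) / 2)"
  have m4: "m ^ 4 = (9 * a\<^sup>2 * b * (a + b) + \<bar>f x\<bar> ^ 4) / 2"
    unfolding m_def using ab by (intro real_root_pow_pos2) auto
  have m0: "0 \<le> m" unfolding m_def using ab by (intro real_root_ge_zero) auto
  have "m ^ 4 < \<bar>f x\<bar> ^ 4" using less m4 by simp
  then have mf: "m < \<bar>f x\<bar>" by (rule power_less_imp_less_base) simp
  define d where "d = (\<bar>f x\<bar> - m) / 2"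
  have d: "d > 0" using mf by (simp add: d_def)
  obtain r where r: "r > 0" "ball x r \<subseteq> U" "\<And>y. y \<in> ball x r \<Longrightarrow> \<bar>f y\<bar> > m + d"
  proof -
    have "isCont f x" using cont U x continuous_on_eq_continuous_at by blast
    then obtain s where s: "s > 0" "\<And>y. dist y x < s \<Longrightarrow> dist (f y) (f x) < d"
      using d unfolding continuous_at_eps_delta by blast
    obtain t where t: "t > 0" "ball x t \<subseteq> U" using U x open_contains_ball by blast
    show ?thesis
    proof (rule that[of "min s t"])
      show "ball x (min s t) \<subseteq> U" using t(2) by auto
      show "\<bar>f y\<bar> > m + d" if "y \<in> ball x (min s t)" for y
        using s(2)[of y] that by (auto simp: dist_commute dist_real_def d_def field_simps abs_if split: if_splits)
    qed (use s t in auto)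
  qed
  define c where "c = sqrt (measure lebesgue (ball x r))"
  have c: "c > 0" using r(1) by (simp add: c_def measure_completion content_ball_pos)
  have "eventually (\<lambda>n. 9 * (a + e n)\<^sup>2 * (b + e n) * ((a + e n) + (b + e n)) < m ^ 4) sequentially"
    by (rule order_tendstoD(2)[OF lim]) (use less m4 in simp)
  moreover have "eventually (\<lambda>n. e n < d * c) sequentially"
    by (rule order_tendstoD(2)[OF e]) (use d c in simp)
  ultimately have "eventually (\<lambda>n. False) sequentially"
  proof eventually_elim
    case (elim n)
    have small: "\<bar>\<phi> n y\<bar> < m" for y
    proof -
      have "\<bar>\<phi> n y\<bar> ^ 4 < m ^ 4" using \<phi>sup[of n y] elim(1) by simp
      then show ?thesis using m0 by (rule power_less_imp_less_base)
    qed
    have "d * c \<le> Lp_norm 2 U (\<lambda>x. f x - \<phi> n x)"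
      unfolding c_def
    proof (rule measure_le_Lp_norm_2)
      show "(\<lambda>x. f x - \<phi> n x) \<in> Lp 2 U" by (intro Lp_2_diff fL test_fun_Lp_2 \<phi>)
      show "emeasure lebesgue (ball x r) < \<infinity>"
        using emeasure_bounded_finite[OF bounded_ball[of x r]] by simp
      show "d \<le> \<bar>f y - \<phi> n y\<bar>" if "y \<in> ball x r" for y
        using r(3)[OF that] small[of y] by linarith
    qed (use r d in auto)
    with fe[of n] elim(2) show False by linarith
  qed
  then show False by simp
qed

section \<open>The displacement for short times\<close>

lemma Lp_norm_2_mono_set:
  fixes f :: "'a::euclidean_space \<Rightarrow> real"
  assumes "f \<in> Lp 2 U" "f \<in> Lp 2 S" "U \<subseteq> S"
  shows "Lp_norm 2 U f \<le> Lp_norm 2 S f"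
  unfolding Lp_norm_2
proof (intro real_sqrt_le_mono integral_mono)
  show "(indicator U x * f x)\<^sup>2 \<le> (indicator S x * f x)\<^sup>2" for x
    using assms(3) by (auto simp: indicator_def)
qed (use assms in \<open>auto simp: Lp_2_iff\<close>)

context semidiscrete_solution
begin

lemma tau_pos: "tau > 0"
  using time_grid by (simp add: tau_def)

lemma eta_tau_eq:
  assumes "t \<in> I k"
  shows "eta_tau t = \<eta> k"
proof -
  have "j = k" if "t \<in> I j" for j
  proof -
    have "real j * tau < real (Suc k) * tau" "real k * tau < real (Suc j) * tau"
      using assms that by (auto simp: I_def)
    then have "j < Suc k" "k < Suc j" using tau_pos by (simp_all del: of_nat_Suc)
    then show ?thesis by simp
  qed
  with assms have "(THE k. t \<in> I k) = k" by (intro the_equality)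
  then show ?thesis by (simp add: eta_tau_def)
qed

lemma time_slab:
  assumes "0 \<le> t" "t \<le> T"
  obtains k where "t \<in> I k" "k \<le> N"
proof -
  define k where "k = nat \<lfloor>t / tau\<rfloor>"
  have "real k = of_int \<lfloor>t / tau\<rfloor>" using assms(1) tau_pos by (simp add: k_def)
  then have "real k \<le> t / tau" "t / tau < real k + 1" by linarith+
  then have k: "real k * tau \<le> t" "t < real (Suc k) * tau"
    using tau_pos by (simp_all add: field_simps)
  have "real k * tau \<le> real N * tau" using k(1) assms(2) time_grid by (simp add: tau_def)
  then have "k \<le> N" using tau_pos by simp
  with k show ?thesis by (intro that[of k]) (simp_all add: I_def)
qed

text \<open>The displacement starts from zero and each time step adds \<open>tau * z k\<close>, so its $L^2$ norm grows at
most linearly in time.\<close>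

lemma eta_L2_le:
  assumes E: "energy_bounds \<alpha> \<beta> \<gamma> c" and k: "k \<le> N"
  shows "\<eta> k \<in> Lp 2 Sig \<and> Lp_norm 2 Sig (\<eta> k) \<le> real k * tau * c"
  using k
proof (induction k)
  case 0
  have eq: "indicator Sig r * \<eta> 0 r = 0" for r
    using initial(1) by (auto simp: indicator_def)
  show ?case unfolding Lp_2_iff Lp_norm_2 eq by simp
next
  case (Suc k)
  have z: "z (Suc k) \<in> Lp 2 Sig" "Lp_norm 2 Sig (z (Suc k)) \<le> c"
    using E Suc.prems unfolding energy_bounds_def by auto
  have eq: "\<eta> (Suc k) = (\<lambda>r. \<eta> k r + tau * z (Suc k) r)"
    using tau_pos by (auto simp: z_def delta_t_def fun_eq_iff)
  have "Lp_norm 2 Sig (\<eta> (Suc k)) \<le> Lp_norm 2 Sig (\<eta> k) + \<bar>tau\<bar> * Lp_norm 2 Sig (z (Suc k))"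
    unfolding eq using Suc Lp_2_add(2)[of "\<eta> k" Sig "\<lambda>r. tau * z (Suc k) r"]
      Lp_2_cmult[OF z(1), of tau] by simp
  also have "\<dots> \<le> real k * tau * c + tau * c"
    using Suc z(2) tau_pos by (intro add_mono mult_left_mono) auto
  finally show ?case
    using Suc Lp_2_add(1)[of "\<eta> k" Sig "\<lambda>r. tau * z (Suc k) r"] Lp_2_cmult(1)[OF z(1), of tau]
    by (subst eq) (simp add: algebra_simps)
qed

text \<open>Interpolation between the small $L^2$ norm and the bounded Laplacian holds at interior points of
$\Sigma$ and extends to its boundary by continuity.\<close>

lemma eta_sup_le:
  assumes E: "energy_bounds \<alpha> \<beta> \<gamma> c" and k: "k \<in> {1..N}" and r: "r \<in> Sig" and s: "real k * tau \<le> s"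
  shows "(\<eta> k r) ^ 4 \<le> 9 * (s * c)\<^sup>2 * (c / \<alpha>) * (s * c + c / \<alpha>)"
proof -
  let ?U = "interior Sig"
  let ?a = "Lp_norm 2 ?U (\<eta> k)" and ?b = "Lp_norm 2 ?U (weak_laplacian ?U (\<eta> k))"
  have U: "?U = box 0 L" by (simp add: Sig_def)
  have "box 0 L \<noteq> {}" using geometry(2) by (auto simp: box_ne_empty Basis_vec_def inner_axis)
  then have cl: "closure ?U = Sig" unfolding U by (simp add: Sig_def closure_box)
  have W0: "\<eta> k \<in> Wkp0 2 2 ?U" using solution_in[OF k] W_space by blast
  then have W: "\<eta> k \<in> Wkp 2 2 ?U" by (simp add: Wkp0_def)
  have cont: "continuous_on Sig (\<eta> k)" using displacement(2) k by simp
  have dim: "DIM(real ^ 'n) \<le> 2" using dimension by auto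
  have lap: "weak_laplacian ?U (\<eta> k) \<in> Lp 2 Sig"
    "\<alpha> * Lp_norm 2 Sig (weak_laplacian ?U (\<eta> k)) \<le> c"
    using E k unfolding energy_bounds_def by auto
  have c: "0 \<le> c"
    using lap(2) parameters(5) Lp_norm_nonneg[of 2 Sig "weak_laplacian ?U (\<eta> k)"]
    by (meson mult_nonneg_nonneg less_imp_le order_trans)
  have s0: "0 \<le> s" using s tau_pos by (meson mult_nonneg_nonneg less_imp_le of_nat_0_le_iff order_trans)
  have eta: "\<eta> k \<in> Lp 2 Sig" "Lp_norm 2 Sig (\<eta> k) \<le> real k * tau * c"
    using eta_L2_le[OF E] k by auto
  have "?a \<le> Lp_norm 2 Sig (\<eta> k)"
    using W eta(1) interior_subset by (intro Lp_norm_2_mono_set) (auto simp: numeral_2_eq_2)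
  also have "\<dots> \<le> s * c" using eta(2) mult_right_mono[OF s c] by linarith
  finally have a: "?a \<le> s * c" .
  have "?b \<le> Lp_norm 2 Sig (weak_laplacian ?U (\<eta> k))"
    using lap(1) interior_subset by (intro Lp_norm_2_mono_set Wkp_2_2_weak_laplacian W)
  also have "\<dots> \<le> c / \<alpha>" using lap(2) parameters(5) by (simp add: field_simps)
  finally have b: "?b \<le> c / \<alpha>" .
  show ?thesis
  proof (rule continuous_le_on_closure[of ?U "\<lambda>r. (\<eta> k r) ^ 4"])
    show "continuous_on (closure ?U) (\<lambda>r. (\<eta> k r) ^ 4)"
      unfolding cl by (intro continuous_intros cont)
    show "r \<in> closure ?U" using r cl by simp
    fix r assume r: "r \<in> ?U"
    have "(\<eta> k r) ^ 4 \<le> 9 * ?a\<^sup>2 * ?b * (?a + ?b)"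
      using interior_subset
      by (intro Wkp0_sup_le_L2_weak_laplacian[OF dim _ W0 _ r] continuous_on_subset[OF cont]) auto
    also have "\<dots> \<le> 9 * (s * c)\<^sup>2 * (c / \<alpha>) * (s * c + c / \<alpha>)"
      using s0 c parameters(5)
      by (intro mult_mono power_mono a b add_mono order_refl mult_nonneg_nonneg
          add_nonneg_nonneg Lp_norm_nonneg) auto
    finally show "(\<eta> k r) ^ 4 \<le> 9 * (s * c)\<^sup>2 * (c / \<alpha>) * (s * c + c / \<alpha>)" .
  qed
qed

end

text \<open>The pointwise bound at times up to \<open>T0 \<le> 1\<close> is of the form \<open>T0\<^sup>2 * K\<close> with
\<open>K\<close> depending only on \<open>c\<close> and \<open>\<alpha>\<close>. Smallness is arranged so that
$|\eta^k|\le H/2$, which suffices because $\delta_0<H/2$.\<close>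

theorem lemma3p8:
  fixes H \<alpha> c \<delta>0 :: real
  assumes "H > 0" and "\<alpha> > 0" and "0 < \<delta>0" and "\<delta>0 < H / 2"
  shows "\<exists>T0>0. \<forall>(L :: real ^ 'n) T N \<eta> \<rho> u a \<gamma> \<mu> lam \<beta> f g \<rho>0 u0 W Q V.
           semidiscrete_solution H L T N \<eta> \<rho> u a \<gamma> \<mu> lam \<alpha> \<beta> f g \<rho>0 u0 W Q V \<longrightarrow>
           fsi.energy_bounds H L T N \<eta> \<rho> u \<alpha> \<beta> \<gamma> c \<longrightarrow>
           (INF (t, r)\<in>{0..min T0 T} \<times> fsi.Sig L. fsi.eta_tau T N \<eta> t r) \<ge> \<delta>0 - H"
proof -
  define K where "K = 9 * c ^ 4 * (1 / \<alpha>) * (1 + 1 / \<alpha>)"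
  have K: "0 \<le> K" using assms(2) by (simp add: K_def)
  \<comment> \<open>Dividing by \<open>K + 1\<close> covers \<open>K = 0\<close>, which occurs when the energy bound is 0.\<close>
  define T0 where "T0 = min 1 ((H / 2)\<^sup>2 / (K + 1))"
  have T0: "0 < T0" "T0 \<le> 1" using K assms(1) by (auto simp: T0_def)
  have "T0 \<le> (H / 2)\<^sup>2 / (K + 1)" by (simp add: T0_def)
  then have "T0 * (K + 1) \<le> (H / 2)\<^sup>2" using K by (simp add: pos_le_divide_eq)
  then have "(T0 * (K + 1))\<^sup>2 \<le> ((H / 2)\<^sup>2)\<^sup>2" using T0 K by (intro power_mono) auto
  moreover have "T0\<^sup>2 * K \<le> (T0 * (K + 1))\<^sup>2"
  proof -
    have "K \<le> (K + 1)\<^sup>2" using K by (simp add: power2_sum)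
    then show ?thesis unfolding power_mult_distrib by (intro mult_left_mono) auto
  qed
  ultimately have small: "T0\<^sup>2 * K \<le> (H / 2) ^ 4" by simp
  show ?thesis
  proof (intro exI[of _ T0] conjI T0(1) allI impI)
    fix L :: "real ^ 'n" and T N \<eta> \<rho> u a \<gamma> \<mu> lam \<beta> f g \<rho>0 u0 W Q V
    assume "semidiscrete_solution H L T N \<eta> \<rho> u a \<gamma> \<mu> lam \<alpha> \<beta> f g \<rho>0 u0 W Q V"
    then interpret semidiscrete_solution H L T N \<eta> \<rho> u a \<gamma> \<mu> lam \<alpha> \<beta> f g \<rho>0 u0 W Q V .
    assume E: "energy_bounds \<alpha> \<beta> \<gamma> c"
    show "\<delta>0 - H \<le> (INF (t, r)\<in>{0..min T0 T} \<times> Sig. eta_tau t r)"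
    proof (rule cINF_greatest)
      have "0 \<in> Sig" using geometry(2) by (auto simp: Sig_def mem_box Basis_vec_def inner_axis less_imp_le)
      then show "{0..min T0 T} \<times> Sig \<noteq> {}" using T0 time_grid by auto
      fix p assume "p \<in> {0..min T0 T} \<times> Sig"
      then obtain t r where p: "p = (t, r)" and t: "0 \<le> t" "t \<le> T0" "t \<le> T" and r: "r \<in> Sig" by auto
      obtain k where k: "t \<in> I k" "k \<le> N" by (rule time_slab[OF t(1,3)])
      have "\<delta>0 - H \<le> \<eta> k r"
      proof (cases "k = 0")
        case True
        then show ?thesis using initial(1)[OF r] assms by simp
      next
        case False
        have "real k * tau \<le> T0" using k(1) t(2) by (simp add: I_def)
        with False k(2) have "(\<eta> k r) ^ 4 \<le> 9 * (T0 * c)\<^sup>2 * (c / \<alpha>) * (T0 * c + c / \<alpha>)"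
          by (intro eta_sup_le[OF E _ r]) auto
        also have "\<dots> = T0\<^sup>2 * (9 * c ^ 4 * (1 / \<alpha>) * (T0 + 1 / \<alpha>))"
          by (simp add: power_mult_distrib power2_eq_square power4_eq_xxxx algebra_simps)
        also have "\<dots> \<le> T0\<^sup>2 * K"
          unfolding K_def using T0 assms(2) by (intro mult_left_mono add_right_mono) auto
        also note small
        finally have "\<bar>\<eta> k r\<bar> ^ 4 \<le> (H / 2) ^ 4" by simp
        then have "\<bar>\<eta> k r\<bar> \<le> H / 2" using assms(1) power_mono_iff[of "\<bar>\<eta> k r\<bar>" "H / 2" 4] by simp
        then show ?thesis using assms by linarith
      qed
      then show "\<delta>0 - H \<le> (case p of (t, r) \<Rightarrow> eta_tau t r)" by (simp add: p eta_tau_eq[OF k(1)])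
    qed
  qed
qed

end
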